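(* There exist constants $C_1, C_2 > 0$ such that \[ C_1 \leq \frac{t_{\mathrm u}((\mathbf{Z}_2^d)^\diamond)}{d\, 2^d} \leq C_2 \quad \text{for all } d \ge 1. \] More generally, \[ C_1 \leq \frac{t_{\mathrm u}((\mathbf{Z}_n^d)^\diamond)}{d\, n^{d+2}} \leq C_2 \quad \text{for all } n \geq 2 \text{ and } d \geq 3. \] (The constants $C_1,C_2$ do not depend on $n$ or $d$.)
   Context: For a finite connected graph $\mathcal{G}$ with vertex set $V(\mathcal{G})$, edge set $E(\mathcal{G})$ and $|\mathcal G|=|V(\mathcal G)|$, lazy random walk on $\mathcal{G}$ is the Markov chain with transition matrix $P(x,x) = 1/2$, $P(x,y) = \frac{1}{2 d(x)}$ if $\{x,y\} \in E(\mathcal{G})$, and $P(x,y)=0$ otherwise, where $d(x)$ is the degree of $x$; its stationary distribution is denoted $\pi_P$. Torus: $\mathbf{Z}_n^d$ is the graph with vertex set $(\mathbf{Z}/n\mathbf{Z})^d$ in which two vertices are adjacent iff they differ in exactly one coordinate, by $\pm 1$ modulo $n$ (for $n=2$ this is the hypercube, which is $d$-regular). Lamplighter walk: the chain $X^\diamond$ on $\mathcal{G}^\diamond = \mathbf{Z}_2 \wr \mathcal{G}$ has states $(f,x)$ with $f\colon V(\mathcal{G}) \to \mathbf{Z}_2$ and $x \in V(\mathcal{G})$. In one step from $(f,x)$ it picks $y$ according to $P(x,\cdot)$ (where $P$ is the lazy random walk kernel on $\mathcal G$), moves the lamplighter to $y$, and resamples the values $f(x)$ and $f(y)$ independently and uniformly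 on $\mathbf{Z}_2$ (if $y=x$ the single value $f(x)$ is resampled); all other values of $f$ are unchanged. Its stationary distribution is $\pi((f,x)) = \pi_P(x) 2^{-|\mathcal{G}|}$. Uniform mixing time: for a Markov chain on a finite state space $V$ with transition matrix $Q$ and stationary distribution $\pi$, the $\epsilon$-uniform mixing time is $\min\{t \ge 0 : \max_{x,y\in V} |Q^t(x,y) - \pi(y)|/\pi(y) \le \epsilon\}$. $t_{\mathrm u}(\mathcal{G}^\diamond)$ denotes the $(2e)^{-1}$-uniform mixing time of $X^\diamond$. *)

theory Defs
  imports "HOL-Probability.Probability" "HOL-Number_Theory.Cong" "HOL-Library.Numeral_Type"
begin

record 'a graph =
  verts :: "'a set"
  edges :: "'a set set"

definition vertex_degree :: "'a graph \<Rightarrow> 'a \<Rightarrow> nat" where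
  "vertex_degree G x = card {y \<in> verts G. {x, y} \<in> edges G}"

text \<open>A Markov chain on a finite state space \<open>V\<close> is given by its transition matrix
  \<open>Q\<close>; only the values of \<open>Q\<close> on \<open>V \<times> V\<close> matter.\<close>

primrec matrix_power :: "'s set \<Rightarrow> ('s \<Rightarrow> 's \<Rightarrow> real) \<Rightarrow> nat \<Rightarrow> 's \<Rightarrow> 's \<Rightarrow> real" where
  "matrix_power V Q 0 x y = (if x = y then 1 else 0)"
| "matrix_power V Q (Suc t) x y = (\<Sum>z\<in>V. matrix_power V Q t x z * Q z y)"

definition is_stationary :: "'s set \<Rightarrow> ('s \<Rightarrow> 's \<Rightarrow> real) \<Rightarrow> ('s \<Rightarrow> real) \<Rightarrow> bool" where
  "is_stationary V Q \<pi> \<longleftrightarrow>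
     (\<forall>x\<in>V. 0 \<le> \<pi> x) \<and> (\<forall>x. x \<notin> V \<longrightarrow> \<pi> x = 0) \<and> (\<Sum>x\<in>V. \<pi> x) = 1 \<and>
     (\<forall>y\<in>V. (\<Sum>x\<in>V. \<pi> x * Q x y) = \<pi> y)"

text \<open>The stationary distribution is unique for an irreducible chain on a finite nonempty \<open>V\<close>;
  the value is arbitrary if there is not exactly one.\<close>

definition stationary_distribution :: "'s set \<Rightarrow> ('s \<Rightarrow> 's \<Rightarrow> real) \<Rightarrow> 's \<Rightarrow> real" where
  "stationary_distribution V Q = (THE \<pi>. is_stationary V Q \<pi>)"

definition uniform_mixing_time ::
    "real \<Rightarrow> 's set \<Rightarrow> ('s \<Rightarrow> 's \<Rightarrow> real) \<Rightarrow> ('s \<Rightarrow> real) \<Rightarrow> nat" where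
  "uniform_mixing_time \<epsilon> V Q \<pi> =
     (LEAST t. (MAX (x, y)\<in>V \<times> V. \<bar>matrix_power V Q t x y - \<pi> y\<bar> / \<pi> y) \<le> \<epsilon>)"

definition lazy_walk :: "'a graph \<Rightarrow> 'a \<Rightarrow> 'a \<Rightarrow> real" where
  "lazy_walk G x y =
     (if y = x then 1 / 2
      else if {x, y} \<in> edges G then 1 / (2 * real (vertex_degree G x))
      else 0)"

text \<open>Lamp configurations are extensional functions \<open>V(G) \<rightarrow> \<int>\<^sub>2\<close>, where \<open>\<int>\<^sub>2\<close> is the
  numeral type \<^typ>\<open>2\<close>; extensionality makes them correspond to the functions on \<open>V(G)\<close>.\<close>

definition lamplighter_states :: "'a graph \<Rightarrow> (('a \<Rightarrow> 2) \<times> 'a) set" where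
  "lamplighter_states G = (verts G \<rightarrow>\<^sub>E UNIV) \<times> verts G"

text \<open>The new lamp values at \<open>x\<close> and \<open>y\<close> are two independent fair bits \<open>a\<close> and \<open>b\<close>. If
  \<open>y = x\<close>, the second update overrides the first, so \<open>f(x)\<close> is resampled as \<open>b\<close>.\<close>

definition lamplighter_walk :: "'a graph \<Rightarrow> ('a \<Rightarrow> 2) \<times> 'a \<Rightarrow> ('a \<Rightarrow> 2) \<times> 'a \<Rightarrow> real" where
  "lamplighter_walk G = (\<lambda>(f, x) (g, y).
     lazy_walk G x y *
     measure_pmf.prob (pair_pmf (pmf_of_set UNIV) (pmf_of_set UNIV)) {(a, b). f(x := a, y := b) = g})"

definition lamplighter_stationary :: "'a graph \<Rightarrow> ('a \<Rightarrow> 2) \<times> 'a \<Rightarrow> real" where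
  "lamplighter_stationary G = (\<lambda>(f, x).
     stationary_distribution (verts G) (lazy_walk G) x / 2 ^ card (verts G))"

definition t_u :: "'a graph \<Rightarrow> nat" where
  "t_u G = uniform_mixing_time (1 / (2 * exp 1))
     (lamplighter_states G) (lamplighter_walk G) (lamplighter_stationary G)"

text \<open>\<open>(\<int>/n\<int>)\<^sup>d\<close> is represented by the functions from \<open>{0,\<dots>,d-1}\<close> to the residues
  \<open>{0,\<dots>,n-1}\<close>. Edges form a set, so there are no multiple edges when \<open>n = 2\<close>, and the condition
  \<open>x i \<noteq> y i\<close> excludes loops when \<open>n = 1\<close>.\<close>

definition torus_adj :: "nat \<Rightarrow> nat \<Rightarrow> (nat \<Rightarrow> int) \<Rightarrow> (nat \<Rightarrow> int) \<Rightarrow> bool" where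
  "torus_adj n d x y \<longleftrightarrow>
     (\<exists>i<d. x i \<noteq> y i \<and> ([y i = x i + 1] (mod int n) \<or> [y i = x i - 1] (mod int n)) \<and>
            (\<forall>j<d. j \<noteq> i \<longrightarrow> y j = x j))"

definition torus :: "nat \<Rightarrow> nat \<Rightarrow> (nat \<Rightarrow> int) graph" where
  "torus n d =
     (let V = {..<d} \<rightarrow>\<^sub>E {0..<int n}
      in \<lparr>verts = V, edges = {{x, y} | x y. x \<in> V \<and> y \<in> V \<and> torus_adj n d x y}\<rparr>)"

end

theory Submission
  imports Defs
begin

text \<open>
Let \<open>N = n ^ d\<close> be the number of vertices of the torus. The lamplighter walk started from \<open>(f, x)\<close> has, at
time \<open>t \<ge> 1\<close>, independent fair bits at all the vertices visited so far and the original bits elsewhere. Everything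
is therefore governed by the law of the unvisited set, and what has to be shown is that an
exponential moment of its size becomes trivial at a time of order \<open>d n\<^sup>2 N\<close>.

Upper bound. Expanding in characters of the lamp group diagonalises the lamps: the transition
probabilities become \<open>2 ^ (- N)\<close> times a signed sum, over all sets \<open>S\<close> of vertices, of the transition
probabilities of the walk killed on \<open>S\<close> (\<open>lamplighter_power_eq_character_sum\<close>). The empty set gives the
equilibrium value up to the mixing of the walk itself. The other sets have to be summed, and there are
about \<open>exp (k (1 + ln (N/k)))\<close> of them with \<open>k\<close> elements. The killed walk decays at a rate given by its lowest
Dirichlet eigenvalue, and a spectral gap alone bounds this below by a multiple of \<open>k / (N d n\<^sup>2)\<close>, which
loses a logarithm. The logarithmic Sobolev inequality recovers it: a function vanishing on a small set
and of order one elsewhere has deviations concentrated on that set, hence large entropy, and the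
eigenvalue is at least a multiple of \<open>k (1 + ln (N/k)) / (N d n\<^sup>2)\<close> (\<open>killed_Poincare\<close>). At a time of order \<open>d n\<^sup>2 N\<close>
this beats the number of sets for all \<open>k\<close> simultaneously (\<open>sum_subsets_exp_le\<close>). The inequality itself is elementary
on a path and tensorises without loss (\<open>log_Sobolev_grid\<close>), so the constants depend on neither \<open>n\<close> nor \<open>d\<close>.

Lower bound. The walk stays in a slab containing at most half of the vertices with probability at
least \<open>exp (- O(t / (d n\<^sup>2)))\<close>, and in that case at least \<open>N/2\<close> lamps are untouched, an event of probability
at most \<open>2 ^ (- N/2)\<close> in equilibrium. These are compatible only if \<open>t\<close> is at least of order \<open>d n\<^sup>2 N\<close>
(\<open>confined_survival_bound\<close>, \<open>torus_mixed_imp_time_ge\<close>).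

For the hypercube the normalisation \<open>d 2 ^ d\<close> differs from \<open>d n ^ (d + 2)\<close> by the factor \<open>4\<close>, which is absorbed
into the upper constant.
\<close>

section \<open>Entropy and a logarithmic Sobolev inequality for grids\<close>

text \<open>Sums over the finite set are kept unnormalised: this is the number of points times the usual
entropy with respect to the uniform distribution. With \<open>ln 0 = 0\<close> the terms at zeros of \<open>F\<close> vanish,
as they should.\<close>

definition entropy :: "'a set \<Rightarrow> ('a \<Rightarrow> real) \<Rightarrow> real" where
  "entropy V F = (\<Sum>x\<in>V. F x * ln (F x)) - (\<Sum>x\<in>V. F x) * ln ((\<Sum>x\<in>V. F x) / real (card V))"

definition mean :: "'a set \<Rightarrow> ('a \<Rightarrow> real) \<Rightarrow> real" where
  "mean V f = (\<Sum>x\<in>V. f x) / real (card V)"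

lemma mult_ln_le:
  fixes x a :: real
  assumes "0 \<le> x" "0 < a"
  shows "x * ln x \<le> x * ln a + x * (x / a - 1)"
proof (cases "x = 0")
  case False
  then have "ln (x / a) \<le> x / a - 1" using assms by (intro ln_le_minus_one) auto
  then have "x * (ln x - ln a) \<le> x * (x / a - 1)"
    using False assms by (intro mult_left_mono) (auto simp: ln_div)
  then show ?thesis by (simp add: algebra_simps)
qed simp

lemma sum_pairwise_square_diff:
  fixes F :: "'a \<Rightarrow> real"
  assumes "finite V"
  shows "(\<Sum>x\<in>V. \<Sum>y\<in>V. (F x - F y)\<^sup>2) = 2 * (real (card V) * (\<Sum>x\<in>V. (F x)\<^sup>2) - (\<Sum>x\<in>V. F x)\<^sup>2)"
proof -
  have "(\<Sum>x\<in>V. \<Sum>y\<in>V. (F x - F y)\<^sup>2)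
      = (\<Sum>x\<in>V. \<Sum>y\<in>V. (F x)\<^sup>2 + (F y)\<^sup>2 - 2 * (F x * F y))"
    by (intro sum.cong refl) (simp add: power2_eq_square algebra_simps)
  also have "\<dots> = 2 * (real (card V) * (\<Sum>x\<in>V. (F x)\<^sup>2) - (\<Sum>x\<in>V. F x)\<^sup>2)"
    by (simp add: sum.distrib sum_subtractf sum_distrib_left[symmetric] sum_product power2_eq_square)
  finally show ?thesis .
qed

text \<open>Using \<open>ln u \<le> u - 1\<close> inside the entropy of \<open>f\<^sup>2\<close> bounds it by the variance of \<open>f\<^sup>2\<close> divided by the
mean of \<open>f\<^sup>2\<close>. Since \<open>f(x)\<^sup>2 - f(y)\<^sup>2\<close> is the product of \<open>f(x) - f(y)\<close>, which is controlled by the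
oscillation, and \<open>f(x) + f(y)\<close>, whose square is at most \<open>2(f(x)\<^sup>2 + f(y)\<^sup>2)\<close>, the mean of \<open>f\<^sup>2\<close>
cancels.\<close>

lemma entropy_square_le_oscillation:
  fixes f :: "'a \<Rightarrow> real"
  assumes "finite V" and osc: "\<And>x y. x \<in> V \<Longrightarrow> y \<in> V \<Longrightarrow> (f x - f y)\<^sup>2 \<le> D" and "0 \<le> D"
  shows "entropy V (\<lambda>x. (f x)\<^sup>2) \<le> 2 * real (card V) * D"
proof -
  define T where "T = (\<Sum>x\<in>V. (f x)\<^sup>2)"
  define N where "N = real (card V)"
  show ?thesis
  proof (cases "T = 0")
    case True
    then have "\<forall>x\<in>V. f x = 0"
      using assms(1) by (simp add: T_def sum_nonneg_eq_0_iff)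
    then show ?thesis using \<open>0 \<le> D\<close> by (simp add: entropy_def)
  next
    case False
    then have T: "T > 0" by (simp add: T_def sum_nonneg less_le)
    then have "V \<noteq> {}" by (auto simp: T_def)
    then have N: "N > 0" using assms(1) by (simp add: N_def card_gt_0_iff)
    have "(\<Sum>x\<in>V. (f x)\<^sup>2 * ln ((f x)\<^sup>2))
        \<le> (\<Sum>x\<in>V. (f x)\<^sup>2 * ln (T / N) + (f x)\<^sup>2 * ((f x)\<^sup>2 / (T / N) - 1))"
      using T N by (intro sum_mono mult_ln_le) auto
    also have "\<dots> = T * ln (T / N) + (\<Sum>x\<in>V. ((f x)\<^sup>2)\<^sup>2) * (N / T) - T"
      by (simp add: sum.distrib sum_subtractf T_def sum_distrib_left sum_distrib_right
          algebra_simps power2_eq_square)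
    finally have 1: "entropy V (\<lambda>x. (f x)\<^sup>2) \<le> (N * (\<Sum>x\<in>V. ((f x)\<^sup>2)\<^sup>2) - T\<^sup>2) / T"
      unfolding entropy_def T_def[symmetric] N_def[symmetric]
      using T by (simp add: field_simps power2_eq_square)
    have "2 * (N * (\<Sum>x\<in>V. ((f x)\<^sup>2)\<^sup>2) - T\<^sup>2) = (\<Sum>x\<in>V. \<Sum>y\<in>V. ((f x)\<^sup>2 - (f y)\<^sup>2)\<^sup>2)"
      unfolding N_def T_def by (rule sum_pairwise_square_diff[symmetric, OF assms(1)])
    also have "\<dots> \<le> (\<Sum>x\<in>V. \<Sum>y\<in>V. D * (2 * ((f x)\<^sup>2 + (f y)\<^sup>2)))"
    proof (intro sum_mono)
      fix x y assume xy: "x \<in> V" "y \<in> V"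
      have "((f x)\<^sup>2 - (f y)\<^sup>2)\<^sup>2 = (f x - f y)\<^sup>2 * (f x + f y)\<^sup>2"
        by (simp add: power2_eq_square algebra_simps)
      also have "\<dots> \<le> D * (2 * ((f x)\<^sup>2 + (f y)\<^sup>2))"
      proof (rule mult_mono[OF osc[OF xy]])
        have "0 \<le> (f x - f y)\<^sup>2" by simp
        then show "(f x + f y)\<^sup>2 \<le> 2 * ((f x)\<^sup>2 + (f y)\<^sup>2)"
          by (simp add: power2_eq_square algebra_simps)
      qed (use \<open>0 \<le> D\<close> in auto)
      finally show "((f x)\<^sup>2 - (f y)\<^sup>2)\<^sup>2 \<le> D * (2 * ((f x)\<^sup>2 + (f y)\<^sup>2))" .
    qed
    also have "\<dots> = 4 * D * N * T"
      by (simp add: sum.distrib sum_distrib_left[symmetric] T_def N_def)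
    finally have "N * (\<Sum>x\<in>V. ((f x)\<^sup>2)\<^sup>2) - T\<^sup>2 \<le> 2 * N * D * T" by (simp add: mult_ac)
    then have "(N * (\<Sum>x\<in>V. ((f x)\<^sup>2)\<^sup>2) - T\<^sup>2) / T \<le> 2 * N * D"
      using T by (simp add: divide_le_eq)
    with 1 show ?thesis by (simp add: N_def)
  qed
qed

lemma square_increment_le_energy:
  fixes g :: "nat \<Rightarrow> real"
  assumes "x < n" "y < n"
  shows "(g x - g y)\<^sup>2 \<le> real n * (\<Sum>j<n - 1. (g (Suc j) - g j)\<^sup>2)"
proof -
  have *: "(g y - g x)\<^sup>2 \<le> real n * (\<Sum>j<n - 1. (g (Suc j) - g j)\<^sup>2)"
    if "x \<le> y" "y < n" for x y
  proof -
    have "g y - g x = (\<Sum>j\<in>{x..<y}. 1 * (g (Suc j) - g j))"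
      using sum_Suc_diff'[OF \<open>x \<le> y\<close>, of g] by simp
    then have "(g y - g x)\<^sup>2 \<le> (\<Sum>j\<in>{x..<y}. 1\<^sup>2) * (\<Sum>j\<in>{x..<y}. (g (Suc j) - g j)\<^sup>2)"
      using Cauchy_Schwarz_ineq_sum[of "\<lambda>_. 1" "\<lambda>j. g (Suc j) - g j" "{x..<y}"] by simp
    also have "\<dots> \<le> real n * (\<Sum>j<n - 1. (g (Suc j) - g j)\<^sup>2)"
      using that by (intro mult_mono sum_mono2) (auto intro: sum_nonneg)
    finally show ?thesis .
  qed
  show ?thesis
    using *[of x y] *[of y x] assms by (cases "x \<le> y") (auto simp: power2_commute)
qed

text \<open>In one dimension the oscillation is at most the total variation, so by Cauchy and Schwarz its square
is at most \<open>n\<close> times the energy. Stating the bound with the edges of the path alone covers \<open>n = 2\<close>,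
where the cycle degenerates to a single edge, together with \<open>n \<ge> 3\<close>.\<close>

lemma log_Sobolev_path:
  fixes f :: "int \<Rightarrow> real"
  shows "entropy {0..<int n} (\<lambda>j. (f j)\<^sup>2)
    \<le> 2 * (real n)\<^sup>2 * (\<Sum>j\<in>{0..<int n}. if j + 1 < int n then (f (j + 1) - f j)\<^sup>2 else 0)"
proof -
  define E where "E = (\<Sum>j\<in>{0..<int n}. if j + 1 < int n then (f (j + 1) - f j)\<^sup>2 else 0)"
  have E: "E = (\<Sum>j<n - 1. (f (int (Suc j)) - f (int j))\<^sup>2)"
  proof -
    have "E = (\<Sum>j<n. if int j + 1 < int n then (f (int j + 1) - f (int j))\<^sup>2 else 0)"
      unfolding E_def by (rule sum.reindex_bij_witness[of _ int nat]) auto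
    also have "\<dots> = (\<Sum>j<n - 1. (f (int (Suc j)) - f (int j))\<^sup>2)"
      by (rule sum.mono_neutral_cong_right) (auto simp: add.commute)
    finally show ?thesis .
  qed
  have "entropy {0..<int n} (\<lambda>j. (f j)\<^sup>2) \<le> 2 * real (card {0..<int n}) * (real n * E)"
  proof (rule entropy_square_le_oscillation)
    fix x y assume "x \<in> {0..<int n}" "y \<in> {0..<int n}"
    then show "(f x - f y)\<^sup>2 \<le> real n * E"
      using square_increment_le_energy[of "nat x" n "nat y" "\<lambda>j. f (int j)"]
      by (simp add: E nat_less_iff)
  qed (auto simp: E intro!: sum_nonneg mult_nonneg_nonneg)
  then show ?thesis by (simp add: E_def power2_eq_square mult.assoc)
qed

definition grid :: "nat \<Rightarrow> nat \<Rightarrow> (nat \<Rightarrow> int) set" where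
  "grid n d = {..<d} \<rightarrow>\<^sub>E {0..<int n}"

definition grid_energy :: "nat \<Rightarrow> nat \<Rightarrow> ((nat \<Rightarrow> int) \<Rightarrow> real) \<Rightarrow> real" where
  "grid_energy n d f = (\<Sum>i<d. \<Sum>x\<in>grid n d. if x i + 1 < int n then (f (x(i := x i + 1)) - f x)\<^sup>2 else 0)"

lemma finite_grid [simp]: "finite (grid n d)"
  by (simp add: grid_def finite_PiE)

lemma card_grid: "card (grid n d) = n ^ d"
  by (simp add: grid_def card_PiE)

lemma sum_grid_Suc:
  fixes F :: "(nat \<Rightarrow> int) \<Rightarrow> 'b::comm_monoid_add"
  shows "(\<Sum>x\<in>grid n (Suc d). F x) = (\<Sum>a\<in>{0..<int n}. \<Sum>b\<in>grid n d. F (b(d := a)))"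
proof -
  have "grid n (Suc d) = (\<lambda>(a, b). b(d := a)) ` ({0..<int n} \<times> grid n d)"
    unfolding grid_def lessThan_Suc by (rule PiE_insert_eq)
  moreover have "inj_on (\<lambda>(a, b). b(d := a)) ({0..<int n} \<times> grid n d)"
    unfolding grid_def by (rule inj_combinator) simp
  ultimately show ?thesis
    by (simp add: sum.reindex sum.cartesian_product case_prod_unfold)
qed

text \<open>Chain rule: the entropy over a product is the sum of the entropies along the fibres plus the entropy
of the fibre sums. Passing from fibre sums to fibre means would only rescale the argument, and the
corresponding \<open>ln (card B)\<close> terms cancel.\<close>

lemma entropy_product:
  fixes F :: "'a \<Rightarrow> 'b \<Rightarrow> real"
  assumes "finite A" "finite B" "A \<noteq> {}" "B \<noteq> {}" "\<And>a b. a \<in> A \<Longrightarrow> b \<in> B \<Longrightarrow> 0 \<le> F a b"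
  shows "(\<Sum>a\<in>A. \<Sum>b\<in>B. F a b * ln (F a b))
       - (\<Sum>a\<in>A. \<Sum>b\<in>B. F a b) * ln ((\<Sum>a\<in>A. \<Sum>b\<in>B. F a b) / (real (card A) * real (card B)))
     = (\<Sum>a\<in>A. entropy B (F a)) + entropy A (\<lambda>a. \<Sum>b\<in>B. F a b)"
proof -
  define G where "G a = (\<Sum>b\<in>B. F a b)" for a
  define cA cB where "cA = real (card A)" and "cB = real (card B)"
  have c: "cA > 0" "cB > 0" using assms by (auto simp: cA_def cB_def card_gt_0_iff)
  have G: "G a \<ge> 0" if "a \<in> A" for a unfolding G_def using assms(5) that by (simp add: sum_nonneg)
  have 1: "t * ln (t / k) = t * ln t - t * ln k" if "t \<ge> 0" "k > 0" for t k :: real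
    using that by (cases "t = 0") (auto simp: ln_div algebra_simps)
  have T: "sum G A \<ge> 0" by (simp add: G sum_nonneg)
  have e: "(\<Sum>a\<in>A. G a * ln (G a / cB)) = (\<Sum>a\<in>A. G a * ln (G a)) - sum G A * ln cB"
    using G c by (simp add: 1 sum_subtractf sum_distrib_right)
  have "sum G A * ln (sum G A / (cA * cB)) = sum G A * ln (sum G A / cA) - sum G A * ln cB"
    using 1[OF T c(1)] 1[OF T, of "cA * cB"] c by (simp add: ln_mult algebra_simps)
  with e show ?thesis
    by (simp add: entropy_def G_def[symmetric] cA_def[symmetric] cB_def[symmetric] sum_subtractf)
qed

lemma square_L2_set_diff_le:
  "(L2_set f A - L2_set g A)\<^sup>2 \<le> (\<Sum>x\<in>A. (f x - g x)\<^sup>2)"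
proof -
  have *: "L2_set f A - L2_set g A \<le> L2_set (\<lambda>x. f x - g x) A" for f g :: "'a \<Rightarrow> real"
    using L2_set_triangle_ineq[of "\<lambda>x. f x - g x" g A] by simp
  have "L2_set (\<lambda>x. g x - f x) A = L2_set (\<lambda>x. f x - g x) A"
    by (simp add: L2_set_def power2_commute)
  then have "\<bar>L2_set f A - L2_set g A\<bar> \<le> L2_set (\<lambda>x. f x - g x) A"
    using *[of f g] *[of g f] by linarith
  then have "(L2_set f A - L2_set g A)\<^sup>2 \<le> (L2_set (\<lambda>x. f x - g x) A)\<^sup>2"
    by (metis L2_set_nonneg abs_le_square_iff abs_of_nonneg)
  then show ?thesis by (simp add: L2_set_def sum_nonneg)
qed

text \<open>Tensorisation, by induction on the dimension. In the chain rule for the last coordinate the fibre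
sums of \<open>f\<^sup>2\<close> are squares of the \<open>L2\<close>-norms of the fibres of \<open>f\<close>. The one-dimensional inequality applies
to these norms, and by the triangle inequality their increments are at most the norms of the
increments of \<open>f\<close>. The constant does not depend on the dimension.\<close>

theorem log_Sobolev_grid:
  assumes "n > 0"
  shows "entropy (grid n d) (\<lambda>x. (f x)\<^sup>2) \<le> 2 * (real n)\<^sup>2 * grid_energy n d f"
proof (induction d arbitrary: f)
  case 0
  then show ?case by (simp add: entropy_def grid_energy_def grid_def)
next
  case (Suc d)
  let ?A = "{0..<int n}" and ?B = "grid n d"
  let ?C = "2 * (real n)\<^sup>2"
  define g where "g a b = f (b(d := a))" for a b
  define G where "G a = (\<Sum>b\<in>?B. (g a b)\<^sup>2)" for a
  have ne: "?A \<noteq> {}" "?B \<noteq> {}" using assms by (auto simp: grid_def PiE_eq_empty_iff)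
  have fin: "finite ?A" "finite ?B" by auto
  have energy: "grid_energy n (Suc d) f = (\<Sum>a\<in>?A. grid_energy n d (g a))
      + (\<Sum>a\<in>?A. \<Sum>b\<in>?B. if a + 1 < int n then (g (a + 1) b - g a b)\<^sup>2 else 0)"
  proof -
    have "(\<Sum>i<d. \<Sum>a\<in>?A. \<Sum>b\<in>?B. if (b(d := a)) i + 1 < int n
               then (f ((b(d := a))(i := (b(d := a)) i + 1)) - f (b(d := a)))\<^sup>2 else 0)
        = (\<Sum>i<d. \<Sum>a\<in>?A. \<Sum>b\<in>?B. if b i + 1 < int n
               then (g a (b(i := b i + 1)) - g a b)\<^sup>2 else 0)"
      by (intro sum.cong refl) (auto simp: g_def fun_upd_twist)
    also have "\<dots> = (\<Sum>a\<in>?A. grid_energy n d (g a))"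
      unfolding grid_energy_def by (rule sum.swap)
    finally show ?thesis
      by (simp add: grid_energy_def[of n "Suc d"] sum_grid_Suc g_def cong: if_cong)
  qed
  have "entropy (grid n (Suc d)) (\<lambda>x. (f x)\<^sup>2)
      = (\<Sum>a\<in>?A. entropy ?B (\<lambda>b. (g a b)\<^sup>2)) + entropy ?A G"
    using entropy_product[OF fin ne, of "\<lambda>a b. (g a b)\<^sup>2"]
    by (simp add: entropy_def[of "grid n (Suc d)"] sum_grid_Suc card_grid g_def[symmetric] G_def[abs_def])
  moreover have "(\<Sum>a\<in>?A. entropy ?B (\<lambda>b. (g a b)\<^sup>2)) \<le> ?C * (\<Sum>a\<in>?A. grid_energy n d (g a))"
    unfolding sum_distrib_left by (intro sum_mono Suc.IH)
  moreover have "entropy ?A G \<le> ?C * (\<Sum>a\<in>?A. \<Sum>b\<in>?B. if a + 1 < int n then (g (a + 1) b - g a b)\<^sup>2 else 0)"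
  proof -
    have G: "G = (\<lambda>a. (L2_set (g a) ?B)\<^sup>2)"
      by (simp add: G_def[abs_def] L2_set_def sum_nonneg)
    have "entropy ?A G \<le> ?C * (\<Sum>a\<in>?A. if a + 1 < int n
        then (L2_set (g (a + 1)) ?B - L2_set (g a) ?B)\<^sup>2 else 0)"
      unfolding G by (rule log_Sobolev_path)
    also have "\<dots> \<le> ?C * (\<Sum>a\<in>?A. \<Sum>b\<in>?B. if a + 1 < int n then (g (a + 1) b - g a b)\<^sup>2 else 0)"
      by (intro mult_left_mono sum_mono) (auto simp: square_L2_set_diff_le)
    finally show ?thesis .
  qed
  ultimately show ?case
    unfolding energy by (simp add: distrib_left)
qed

section \<open>Lazy symmetric chains: decay of killed semigroups\<close>

locale lazy_symmetric_chain =
  fixes V :: "'a set" and P :: "'a \<Rightarrow> 'a \<Rightarrow> real"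
  assumes finite_V: "finite V" and V_nonempty: "V \<noteq> {}"
    and P_nonneg: "\<And>x y. x \<in> V \<Longrightarrow> y \<in> V \<Longrightarrow> 0 \<le> P x y"
    and P_sym: "\<And>x y. x \<in> V \<Longrightarrow> y \<in> V \<Longrightarrow> P x y = P y x"
    and P_row: "\<And>x. x \<in> V \<Longrightarrow> (\<Sum>y\<in>V. P x y) = 1"
    and P_lazy: "\<And>x. x \<in> V \<Longrightarrow> 1 / 2 \<le> P x x"
begin

text \<open>The Dirichlet form with respect to counting measure.\<close>

definition dirichlet :: "('a \<Rightarrow> real) \<Rightarrow> real" where
  "dirichlet f = (\<Sum>x\<in>V. \<Sum>y\<in>V. P x y * (f x - f y)\<^sup>2) / 2"

text \<open>The transition operator of the chain killed on entering \<open>S\<close>. Both the starting point and the next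
position have to avoid \<open>S\<close>, so the \<open>t\<close>-th iterate at \<open>x\<close> is the expectation of \<open>f(X\<^sub>t)\<close> on the event
that none of \<open>X\<^sub>0, \<dots>, X\<^sub>t\<close> lies in \<open>S\<close>, for \<open>t \<ge> 1\<close>; the zeroth iterate is \<open>f\<close> itself.\<close>

definition killed :: "'a set \<Rightarrow> ('a \<Rightarrow> real) \<Rightarrow> 'a \<Rightarrow> real" where
  "killed S f x = (if x \<in> S then 0 else \<Sum>y\<in>V - S. P x y * f y)"

lemma card_V_pos: "0 < real (card V)"
  using finite_V V_nonempty by (simp add: card_gt_0_iff)

lemma P_column: "y \<in> V \<Longrightarrow> (\<Sum>x\<in>V. P x y) = 1"
  using P_row[of y] by (simp add: P_sym cong: sum.cong)

lemma dirichlet_nonneg: "0 \<le> dirichlet f"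
  unfolding dirichlet_def by (intro divide_nonneg_pos sum_nonneg mult_nonneg_nonneg) (auto simp: P_nonneg)

lemma dirichlet_shift: "dirichlet (\<lambda>x. f x - c) = dirichlet f"
  by (simp add: dirichlet_def)

lemma sum_double_left: "(\<Sum>x\<in>V. \<Sum>y\<in>V. P x y * h x) = (\<Sum>x\<in>V. h x)"
  by (simp add: sum_distrib_right[symmetric] P_row)

lemma sum_double_right: "(\<Sum>x\<in>V. \<Sum>y\<in>V. P x y * h y) = (\<Sum>y\<in>V. h y)"
  by (subst sum.swap) (simp add: sum_distrib_right[symmetric] P_column)

lemma dirichlet_eq:
  "dirichlet f = (\<Sum>x\<in>V. (f x)\<^sup>2) - (\<Sum>x\<in>V. f x * (\<Sum>y\<in>V. P x y * f y))"
proof -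
  have "(\<Sum>x\<in>V. \<Sum>y\<in>V. P x y * (f x - f y)\<^sup>2)
      = (\<Sum>x\<in>V. \<Sum>y\<in>V. P x y * (f x)\<^sup>2) + (\<Sum>x\<in>V. \<Sum>y\<in>V. P x y * (f y)\<^sup>2)
      - 2 * (\<Sum>x\<in>V. \<Sum>y\<in>V. f x * (P x y * f y))"
    unfolding sum_distrib_left sum.distrib[symmetric] sum_subtractf[symmetric]
    by (intro sum.cong refl) (simp add: power2_eq_square algebra_simps)
  then show ?thesis
    unfolding dirichlet_def sum_double_left sum_double_right
    by (simp add: sum_distrib_left[symmetric])
qed

text \<open>Laziness makes the spectrum of \<open>P\<close> nonnegative, so that \<open>P\<^sup>2 \<le> P\<close> as quadratic forms. Without spectral
theory: \<open>W = 2P - 1\<close> is again stochastic and symmetric, hence a contraction by Jensen's inequality, and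
\<open>f \<cdot> Pf - (Pf)\<^sup>2 = (f\<^sup>2 - (Wf)\<^sup>2) / 4\<close> pointwise.\<close>

lemma square_norm_step_le:
  "(\<Sum>x\<in>V. (\<Sum>y\<in>V. P x y * f y)\<^sup>2) \<le> (\<Sum>x\<in>V. (f x)\<^sup>2) - dirichlet f"
proof -
  define Pf where "Pf x = (\<Sum>y\<in>V. P x y * f y)" for x
  have "(\<Sum>x\<in>V. (2 * Pf x - f x)\<^sup>2)
      \<le> (\<Sum>x\<in>V. 2 * (\<Sum>y\<in>V. P x y * (f y)\<^sup>2) - (f x)\<^sup>2)"
  proof (rule sum_mono)
    fix x assume x: "x \<in> V"
    define W where "W y = 2 * P x y - (if y = x then 1 else 0)" for y
    define c where "c = (\<Sum>y\<in>V. W y * f y)"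
    have delta: "(\<Sum>y\<in>V. (if y = x then 1 else 0) * h y) = h x" for h :: "'a \<Rightarrow> real"
    proof -
      have "(\<Sum>y\<in>V. (if y = x then 1 else 0) * h y) = (\<Sum>y\<in>V. if y = x then h y else 0)"
        by (intro sum.cong) auto
      then show ?thesis using x finite_V by simp
    qed
    have W: "(\<Sum>y\<in>V. W y * h y) = 2 * (\<Sum>y\<in>V. P x y * h y) - h x" for h
      unfolding W_def left_diff_distrib sum_subtractf delta
      by (simp add: sum_distrib_left mult.assoc)
    have W1: "(\<Sum>y\<in>V. W y) = 1"
      using W[of "\<lambda>_. 1"] P_row[OF x] by simp
    have "0 \<le> (\<Sum>y\<in>V. W y * (f y - c)\<^sup>2)"
      using x P_nonneg P_lazy[OF x] by (intro sum_nonneg mult_nonneg_nonneg) (auto simp: W_def)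
    also have "\<dots> = (\<Sum>y\<in>V. W y * (f y)\<^sup>2) - 2 * c * (\<Sum>y\<in>V. W y * f y) + c\<^sup>2 * (\<Sum>y\<in>V. W y)"
      unfolding sum_distrib_left sum.distrib[symmetric] sum_subtractf[symmetric]
      by (intro sum.cong refl) (simp add: power2_eq_square algebra_simps)
    also have "\<dots> = (\<Sum>y\<in>V. W y * (f y)\<^sup>2) - c\<^sup>2"
      by (simp add: W1 c_def[symmetric] power2_eq_square)
    finally show "(2 * Pf x - f x)\<^sup>2 \<le> 2 * (\<Sum>y\<in>V. P x y * (f y)\<^sup>2) - (f x)\<^sup>2"
      by (simp add: c_def W Pf_def)
  qed
  also have "\<dots> = (\<Sum>x\<in>V. (f x)\<^sup>2)"
    by (simp add: sum_subtractf sum_distrib_left[symmetric] sum_double_right)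
  finally have "(\<Sum>x\<in>V. (2 * Pf x - f x)\<^sup>2) \<le> (\<Sum>x\<in>V. (f x)\<^sup>2)" .
  moreover have "(\<Sum>x\<in>V. (2 * Pf x - f x)\<^sup>2)
      = 4 * (\<Sum>x\<in>V. (Pf x)\<^sup>2) - 4 * (\<Sum>x\<in>V. f x * Pf x) + (\<Sum>x\<in>V. (f x)\<^sup>2)"
    unfolding sum_distrib_left sum.distrib[symmetric] sum_subtractf[symmetric]
    by (intro sum.cong refl) (simp add: power2_eq_square algebra_simps)
  ultimately have "(\<Sum>x\<in>V. (Pf x)\<^sup>2) \<le> (\<Sum>x\<in>V. f x * Pf x)" by simp
  then show ?thesis by (simp add: dirichlet_eq Pf_def)
qed

lemma square_norm_killed_le:
  fixes f :: "'a \<Rightarrow> real" and S :: "'a set"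
  defines "f' \<equiv> \<lambda>x. if x \<in> S then 0 else f x"
  shows "(\<Sum>x\<in>V. (killed S f x)\<^sup>2) \<le> (\<Sum>x\<in>V. (f' x)\<^sup>2) - dirichlet f'"
proof -
  have "(\<Sum>x\<in>V. (killed S f x)\<^sup>2) \<le> (\<Sum>x\<in>V. (\<Sum>y\<in>V. P x y * f' y)\<^sup>2)"
  proof (rule sum_mono)
    fix x assume "x \<in> V"
    have "(\<Sum>y\<in>V. P x y * f' y) = (\<Sum>y\<in>V - S. P x y * f y)"
      by (rule sum.mono_neutral_cong_right) (auto simp: finite_V f'_def)
    then show "(killed S f x)\<^sup>2 \<le> (\<Sum>y\<in>V. P x y * f' y)\<^sup>2"
      by (simp add: killed_def)
  qed
  also have "\<dots> \<le> (\<Sum>x\<in>V. (f' x)\<^sup>2) - dirichlet f'"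
    by (rule square_norm_step_le)
  finally show ?thesis .
qed

text \<open>One step is lost because \<open>f\<close> need not vanish on \<open>S\<close>; the first application of the operator
arranges this, and from then on the assumed spectral bound applies.\<close>

lemma killed_decay:
  assumes gap: "\<And>f. (\<And>x. x \<in> S \<Longrightarrow> f x = 0) \<Longrightarrow> \<delta> * (\<Sum>x\<in>V. (f x)\<^sup>2) \<le> dirichlet f"
    and "\<delta> \<le> 1"
  shows "(\<Sum>x\<in>V. ((killed S ^^ Suc t) f x)\<^sup>2) \<le> (1 - \<delta>) ^ t * (\<Sum>x\<in>V. (f x)\<^sup>2)"
proof (induction t)
  case 0
  have "(\<Sum>x\<in>V. (killed S f x)\<^sup>2) \<le> (\<Sum>x\<in>V. (if x \<in> S then 0 else f x)\<^sup>2)"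
    using square_norm_killed_le[of S f] dirichlet_nonneg by (smt (verit))
  also have "\<dots> \<le> (\<Sum>x\<in>V. (f x)\<^sup>2)" by (intro sum_mono) auto
  finally show ?case by simp
next
  case (Suc t)
  let ?g = "(killed S ^^ Suc t) f"
  have g0: "?g x = 0" if "x \<in> S" for x using that by (simp add: killed_def)
  then have g: "(if x \<in> S then 0 else ?g x) = ?g x" for x by simp
  have "(\<Sum>x\<in>V. (killed S ?g x)\<^sup>2) \<le> (\<Sum>x\<in>V. (?g x)\<^sup>2) - dirichlet ?g"
    using square_norm_killed_le[of S ?g] by (simp only: g)
  also have "\<dots> \<le> (1 - \<delta>) * (\<Sum>x\<in>V. (?g x)\<^sup>2)"
    using gap[OF g0] by (simp add: algebra_simps)
  also have "\<dots> \<le> (1 - \<delta>) * ((1 - \<delta>) ^ t * (\<Sum>x\<in>V. (f x)\<^sup>2))"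
    using assms(2) by (intro mult_left_mono Suc.IH) auto
  finally show ?case by simp
qed

lemma sum_killed_empty: "(\<Sum>x\<in>V. killed {} f x) = (\<Sum>x\<in>V. f x)"
  by (simp add: killed_def sum_double_right)

lemma mean_decay:
  assumes gap: "\<And>f. \<gamma> * (\<Sum>x\<in>V. (f x - mean V f)\<^sup>2) \<le> dirichlet f" and "\<gamma> \<le> 1"
  shows "(\<Sum>x\<in>V. ((killed {} ^^ t) f x - mean V f)\<^sup>2) \<le> (1 - \<gamma>) ^ t * (\<Sum>x\<in>V. (f x - mean V f)\<^sup>2)"
proof (induction t)
  case (Suc t)
  let ?g = "(killed {} ^^ t) f"
  let ?h = "\<lambda>x. ?g x - mean V f"
  have mean: "mean V ((killed {} ^^ t) f) = mean V f" for t
    by (induction t) (simp_all add: mean_def sum_killed_empty)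
  have "killed {} ?g x - mean V f = (\<Sum>y\<in>V. P x y * ?h y)" if "x \<in> V" for x
    using P_row[OF that]
    by (simp add: killed_def right_diff_distrib sum_subtractf sum_distrib_right[symmetric])
  then have "(\<Sum>x\<in>V. ((killed {} ^^ Suc t) f x - mean V f)\<^sup>2) \<le> (\<Sum>x\<in>V. (?h x)\<^sup>2) - dirichlet ?h"
    using square_norm_step_le[of ?h] by simp
  also have "\<dots> \<le> (1 - \<gamma>) * (\<Sum>x\<in>V. (?h x)\<^sup>2)"
    using gap[of ?g] unfolding mean dirichlet_shift by (simp add: algebra_simps)
  also have "\<dots> \<le> (1 - \<gamma>) * ((1 - \<gamma>) ^ t * (\<Sum>x\<in>V. (f x - mean V f)\<^sup>2))"
    using assms(2) by (intro mult_left_mono Suc.IH) auto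
  finally show ?case by simp
qed simp

end

section \<open>Spectral bounds from the logarithmic Sobolev inequality\<close>

text \<open>Gibbs' variational principle, which turns an entropy into a lower bound tested by a chosen \<open>h\<close>.\<close>

lemma entropy_variational:
  assumes "finite V" "\<And>x. x \<in> V \<Longrightarrow> 0 \<le> F x" "(\<Sum>x\<in>V. exp (h x)) \<le> real (card V)"
  shows "(\<Sum>x\<in>V. F x * h x) \<le> entropy V F"
proof -
  define T N where "T = (\<Sum>x\<in>V. F x)" and "N = real (card V)"
  show ?thesis
  proof (cases "T = 0")
    case True
    then have "\<forall>x\<in>V. F x = 0" using assms by (simp add: T_def sum_nonneg_eq_0_iff)
    then show ?thesis by (simp add: entropy_def)
  next
    case False
    then have T: "T > 0" using assms by (simp add: T_def sum_nonneg less_le)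
    then have "V \<noteq> {}" by (auto simp: T_def)
    then have N: "N > 0" using assms(1) by (simp add: N_def card_gt_0_iff)
    have "F x * h x \<le> F x * ln (F x) - F x * ln (T / N) + (T / N * exp (h x) - F x)" if "x \<in> V" for x
    proof (cases "F x = 0")
      case False
      then have Fx: "F x > 0" using assms(2)[OF that] by simp
      define u where "u = T / N * exp (h x) / F x"
      have u: "u > 0" using T N Fx by (simp add: u_def)
      have "ln u \<le> u - 1" using u by (rule ln_le_minus_one)
      then have "F x * ln u \<le> F x * (u - 1)" using Fx by simp
      moreover have "ln u = ln (T / N) + h x - ln (F x)"
        using T N Fx by (simp add: u_def ln_div ln_mult)
      moreover have "F x * (u - 1) = T / N * exp (h x) - F x"
        using Fx by (simp add: u_def field_simps)
      ultimately show ?thesis by (simp add: algebra_simps)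
    qed (use T N in simp)
    then have "(\<Sum>x\<in>V. F x * h x)
        \<le> (\<Sum>x\<in>V. F x * ln (F x) - F x * ln (T / N) + (T / N * exp (h x) - F x))"
      by (rule sum_mono)
    also have "\<dots> = entropy V F + (T / N * (\<Sum>x\<in>V. exp (h x)) - T)"
      by (simp add: entropy_def T_def N_def sum.distrib sum_subtractf sum_distrib_left sum_distrib_right sum_divide_distrib)
    also have "\<dots> \<le> entropy V F"
    proof -
      have "T / N * (\<Sum>x\<in>V. exp (h x)) \<le> T / N * N"
        using assms(3) T N by (intro mult_left_mono) (auto simp: N_def)
      then show ?thesis using N by simp
    qed
    finally show ?thesis .
  qed
qed

lemma sum_square_mean_eq:
  assumes "finite V" "V \<noteq> {}"
  shows "(\<Sum>x\<in>V. (f x - mean V f)\<^sup>2) = (\<Sum>x\<in>V. (f x)\<^sup>2) - real (card V) * (mean V f)\<^sup>2"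
proof -
  have N: "real (card V) > 0" using assms by (simp add: card_gt_0_iff)
  have s: "(\<Sum>x\<in>V. f x) = real (card V) * mean V f" using N by (simp add: mean_def)
  have "(\<Sum>x\<in>V. (f x - mean V f)\<^sup>2)
      = (\<Sum>x\<in>V. (f x)\<^sup>2) - 2 * mean V f * (\<Sum>x\<in>V. f x) + real (card V) * (mean V f)\<^sup>2"
    by (simp add: power2_diff sum.distrib sum_subtractf sum_distrib_left sum_distrib_right mult_ac)
  then show ?thesis by (simp add: s power2_eq_square)
qed

text \<open>For \<open>r\<close> the quadratic mean of \<open>f\<close>, \<open>ln (f/r) \<ge> 1 - r/f\<close> bounds the entropy below by twice the sum of
\<open>f\<^sup>2 - r f\<close>. This exceeds the variance by \<open>N (r - m)\<^sup>2\<close>, where \<open>m\<close> is the arithmetic mean.\<close>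

lemma variance_le_entropy:
  assumes "finite V" "V \<noteq> {}" "\<And>x. x \<in> V \<Longrightarrow> 0 < f x"
  shows "(\<Sum>x\<in>V. (f x - mean V f)\<^sup>2) \<le> entropy V (\<lambda>x. (f x)\<^sup>2)"
proof -
  define N where "N = real (card V)"
  have N: "N > 0" using assms by (simp add: N_def card_gt_0_iff)
  define q where "q = (\<Sum>x\<in>V. (f x)\<^sup>2)"
  define r where "r = sqrt (q / N)"
  have "q > 0" unfolding q_def using assms by (intro sum_pos) (auto simp: less_le)
  then have r: "r > 0" "r\<^sup>2 = q / N" using N by (auto simp: r_def)
  have s: "(\<Sum>x\<in>V. f x) = N * mean V f" using N by (simp add: mean_def N_def)
  have "(\<Sum>x\<in>V. 2 * ((f x)\<^sup>2 - r * f x)) \<le> (\<Sum>x\<in>V. (f x)\<^sup>2 * ln ((f x)\<^sup>2) - (f x)\<^sup>2 * ln (q / N))"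
  proof (rule sum_mono)
    fix x assume "x \<in> V"
    then have fx: "f x > 0" by (rule assms(3))
    have "ln (r / f x) \<le> r / f x - 1" using fx r by (intro ln_le_minus_one) auto
    then have "(f x)\<^sup>2 * (1 - r / f x) \<le> (f x)\<^sup>2 * (ln (f x) - ln r)"
      using fx r by (intro mult_left_mono) (auto simp: ln_div)
    then show "2 * ((f x)\<^sup>2 - r * f x) \<le> (f x)\<^sup>2 * ln ((f x)\<^sup>2) - (f x)\<^sup>2 * ln (q / N)"
      using fx r unfolding r(2)[symmetric] ln_realpow by (simp add: algebra_simps power2_eq_square)
  qed
  also have "\<dots> = entropy V (\<lambda>x. (f x)\<^sup>2)"
    by (simp add: entropy_def q_def N_def sum_subtractf sum_distrib_right)
  finally have "2 * (q - r * (N * mean V f)) \<le> entropy V (\<lambda>x. (f x)\<^sup>2)"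
    by (simp add: sum_distrib_left[symmetric] sum_subtractf q_def s)
  moreover have "q - N * (mean V f)\<^sup>2 \<le> 2 * (q - r * (N * mean V f))"
  proof -
    have "0 \<le> N * (r - mean V f)\<^sup>2" using N by simp
    also have "\<dots> = N * r\<^sup>2 - 2 * r * (N * mean V f) + N * (mean V f)\<^sup>2"
      by (simp add: power2_eq_square algebra_simps)
    also have "N * r\<^sup>2 = q" using r N by simp
    finally show ?thesis by (simp add: algebra_simps)
  qed
  ultimately show ?thesis
    by (simp add: sum_square_mean_eq[OF assms(1,2)] q_def N_def)
qed

text \<open>The bound \<open>1 \<le> C\<close> guarantees that the decay rates built from \<open>1 / C\<close> do not exceed one.\<close>

locale log_Sobolev_chain = lazy_symmetric_chain +
  fixes C :: real
  assumes C_ge_1: "1 \<le> C"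
    and log_Sobolev: "\<And>f. entropy V (\<lambda>x. (f x)\<^sup>2) \<le> C * dirichlet f"
begin

text \<open>Variance and Dirichlet form ignore additive constants, so \<open>f\<close> may be assumed positive.\<close>

lemma Poincare: "(\<Sum>x\<in>V. (f x - mean V f)\<^sup>2) \<le> C * dirichlet f"
proof -
  define c where "c = Min (f ` V) - 1"
  have c: "f x - c > 0" if "x \<in> V" for x
  proof -
    have "Min (f ` V) \<le> f x" using that finite_V by (intro Min_le) auto
    then show ?thesis by (simp add: c_def)
  qed
  have "mean V (\<lambda>x. f x - c) = mean V f - c"
    using card_V_pos by (simp add: mean_def sum_subtractf field_simps)
  then have "(\<Sum>x\<in>V. (f x - mean V f)\<^sup>2) = (\<Sum>x\<in>V. (f x - c - mean V (\<lambda>x. f x - c))\<^sup>2)"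
    by simp
  also have "\<dots> \<le> entropy V (\<lambda>x. (f x - c)\<^sup>2)"
    by (rule variance_le_entropy[OF finite_V V_nonempty c])
  also have "\<dots> \<le> C * dirichlet f"
    using log_Sobolev[of "\<lambda>x. f x - c"] by (simp add: dirichlet_shift)
  finally show ?thesis .
qed

text \<open>The heart of the upper bound: a set of \<open>k\<close> out of \<open>N\<close> points is hit at a rate that exceeds the trivial
spectral gap bound \<open>k/N\<close> by the factor \<open>1 + ln (N/k)\<close>, which is exactly what pays for the number
of such sets. The reason: if \<open>f\<close> vanishes on \<open>S\<close> but is not small in mean, then \<open>f - m\<close> equals \<open>-m\<close> on the
small set \<open>S\<close>, so the square of \<open>f - m\<close> has entropy of order \<open>k m\<^sup>2 ln (N/k)\<close>. If \<open>m\<close> is small, the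
variance is comparable with the sum of \<open>f\<^sup>2\<close> and the Poincare inequality suffices.\<close>

lemma killed_Poincare:
  fixes S :: "'a set"
  defines "k \<equiv> real (card S)" and "N \<equiv> real (card V)"
  assumes S: "S \<subseteq> V" "S \<noteq> {}" and f0: "\<And>x. x \<in> S \<Longrightarrow> f x = 0"
  shows "k * (1 + ln (N / k)) / N * (\<Sum>x\<in>V. (f x)\<^sup>2) \<le> 5 * C * dirichlet f"
proof -
  define m where "m = mean V f"
  define v where "v = (\<Sum>x\<in>V. (f x - m)\<^sup>2)"
  define E where "E = C * dirichlet f"
  have finS: "finite S" using S finite_V finite_subset by blast
  have k: "k > 0" "k \<le> N" using S finS finite_V card_mono[of V S] by (auto simp: k_def N_def card_gt_0_iff)
  have N: "N > 0" using k by simp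
  have on_S: "(\<Sum>x\<in>V. (f x - m)\<^sup>2 * (if x \<in> S then a else b))
      = k * m\<^sup>2 * a + (v - k * m\<^sup>2) * b" for a b :: real
  proof -
    have 1: "(\<Sum>x\<in>S. (f x - m)\<^sup>2) = k * m\<^sup>2" by (simp add: f0 k_def)
    have 2: "v = (\<Sum>x\<in>V - S. (f x - m)\<^sup>2) + (\<Sum>x\<in>S. (f x - m)\<^sup>2)"
      unfolding v_def by (rule sum.subset_diff[OF S(1) finite_V])
    have "(\<Sum>x\<in>V. (f x - m)\<^sup>2 * (if x \<in> S then a else b))
        = (\<Sum>x\<in>V - S. (f x - m)\<^sup>2 * (if x \<in> S then a else b)) + (\<Sum>x\<in>S. (f x - m)\<^sup>2 * (if x \<in> S then a else b))"
      by (rule sum.subset_diff[OF S(1) finite_V])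
    also have "(\<Sum>x\<in>V - S. (f x - m)\<^sup>2 * (if x \<in> S then a else b)) = (\<Sum>x\<in>V - S. (f x - m)\<^sup>2) * b"
      by (simp add: sum_distrib_right)
    also have "(\<Sum>x\<in>S. (f x - m)\<^sup>2 * (if x \<in> S then a else b)) = (\<Sum>x\<in>S. (f x - m)\<^sup>2) * a"
      by (simp add: sum_distrib_right)
    finally show ?thesis using 1 2 by simp
  qed
  have E: "E \<ge> 0" using C_ge_1 dirichlet_nonneg by (simp add: E_def)
  have v: "v \<le> E" unfolding v_def m_def E_def by (rule Poincare)
  have vk: "k * m\<^sup>2 \<le> v"
  proof -
    have "(\<Sum>x\<in>S. (f x - m)\<^sup>2) \<le> v" unfolding v_def by (rule sum_mono2[OF finite_V S(1)]) auto
    then show ?thesis by (simp add: f0 k_def)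
  qed
  \<comment> \<open>Half of the total mass \<open>N\<close> of \<open>exp h\<close> is spread over \<open>S\<close>, and the rest is at most \<open>N/2\<close>.\<close>
  define h where "h x = (if x \<in> S then ln (N / (2 * k)) else ln (1 / 2))" for x
  have "(\<Sum>x\<in>V. exp (h x)) = (\<Sum>x\<in>V - S. 1 / 2) + (\<Sum>x\<in>S. N / (2 * k))"
    using k N by (subst sum.subset_diff[OF S(1) finite_V]) (simp add: h_def)
  also have "\<dots> \<le> N"
    using k N finS S finite_V by (simp add: card_Diff_subset k_def[symmetric] N_def[symmetric]
        of_nat_diff card_mono) (simp add: k_def field_simps)
  finally have "(\<Sum>x\<in>V. (f x - m)\<^sup>2 * h x) \<le> entropy V (\<lambda>x. (f x - m)\<^sup>2)"
    by (intro entropy_variational finite_V) (auto simp: N_def)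
  also have "\<dots> \<le> E"
    using log_Sobolev[of "\<lambda>x. f x - m"] by (simp add: dirichlet_shift E_def)
  finally have *: "k * m\<^sup>2 * ln (N / (2 * k)) + (v - k * m\<^sup>2) * ln (1 / 2) \<le> E"
    unfolding h_def on_S .
  have ln: "ln (N / (2 * k)) = ln (N / k) - ln 2" "ln (1 / 2 :: real) = - ln 2"
    using k N by (auto simp: ln_div ln_mult)
  from * have "k * m\<^sup>2 * ln (N / k) \<le> E + v * ln 2"
    unfolding ln by (simp add: algebra_simps)
  also have "v * ln 2 \<le> E * 1"
    using E ln_2_less_1 by (intro mult_mono[OF v]) auto
  finally have main: "k * m\<^sup>2 * (1 + ln (N / k)) \<le> 4 * E"
    using vk v E by (simp add: algebra_simps)
  define \<theta> where "\<theta> = k * (1 + ln (N / k)) / N"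
  have "1 + ln (N / k) \<le> N / k" using ln_le_minus_one[of "N / k"] k N by simp
  then have \<theta>: "\<theta> \<le> 1" using k N by (simp add: \<theta>_def field_simps)
  have "(\<Sum>x\<in>V. (f x)\<^sup>2) = v + N * m\<^sup>2"
    unfolding v_def m_def N_def by (simp add: sum_square_mean_eq[OF finite_V V_nonempty])
  then have "\<theta> * (\<Sum>x\<in>V. (f x)\<^sup>2) = \<theta> * v + k * m\<^sup>2 * (1 + ln (N / k))"
    using N by (simp add: \<theta>_def field_simps)
  also have "\<theta> * v \<le> 1 * v"
    using \<theta> by (intro mult_right_mono) (auto simp: v_def sum_nonneg)
  finally show ?thesis using main v by (simp add: \<theta>_def E_def)
qed

end

section \<open>Lazy random walk on the torus\<close>

text \<open>For \<open>n = 2\<close> the steps \<open>+1\<close> and \<open>-1\<close> lead to the same neighbour, which is counted once.\<close>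

definition steps :: "nat \<Rightarrow> int set" where
  "steps n = (if n = 2 then {1} else {1, -1})"

definition coord_shift :: "nat \<Rightarrow> nat \<Rightarrow> int \<Rightarrow> (nat \<Rightarrow> int) \<Rightarrow> nat \<Rightarrow> int" where
  "coord_shift n i s x = x(i := (x i + s) mod int n)"

lemma finite_steps [simp]: "finite (steps n)"
  by (simp add: steps_def)

lemma card_steps: "card (steps n) > 0" "card (steps n) \<le> 2"
  by (auto simp: steps_def)

lemma verts_torus [simp]: "verts (torus n d) = grid n d"
  by (simp add: torus_def grid_def Let_def)

lemma grid_memD: "x \<in> grid n d \<Longrightarrow> i < d \<Longrightarrow> 0 \<le> x i \<and> x i < int n"
  by (auto simp: grid_def PiE_iff)

lemma grid_update: "x \<in> grid n d \<Longrightarrow> i < d \<Longrightarrow> 0 \<le> a \<Longrightarrow> a < int n \<Longrightarrow> x(i := a) \<in> grid n d"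
  by (auto simp: grid_def PiE_iff extensional_def)

lemma coord_shift_in_grid: "n \<ge> 1 \<Longrightarrow> x \<in> grid n d \<Longrightarrow> i < d \<Longrightarrow> coord_shift n i s x \<in> grid n d"
  unfolding coord_shift_def by (intro grid_update) auto

lemma mod_add_step_neq:
  assumes "n \<ge> 2" "s \<in> steps n"
  shows "(a + s) mod int n \<noteq> a"
proof
  assume "(a + s) mod int n = a"
  then have "(a + s) mod int n = a mod int n" by (metis mod_mod_trivial)
  then have "int n dvd s" by (metis add_diff_cancel_left' mod_eq_dvd_iff)
  then have "int n \<le> \<bar>s\<bar>"
    using assms dvd_imp_le_int[of s "int n"] by (auto simp: steps_def split: if_splits)
  then show False using assms by (auto simp: steps_def split: if_splits)
qed

lemma mod_add_step_inj:
  assumes "n \<ge> 2" "s \<in> steps n" "s' \<in> steps n" "(a + s) mod int n = (a + s') mod int n"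
  shows "s = s'"
proof (rule ccontr)
  assume "s \<noteq> s'"
  then have "n \<ge> 3" and s: "\<bar>s - s'\<bar> = 2" using assms by (auto simp: steps_def split: if_splits)
  have "int n dvd s - s'" using assms(4) by (metis add_diff_cancel_left mod_eq_dvd_iff)
  then have "int n \<le> \<bar>s - s'\<bar>" using s dvd_imp_le_int[of "s - s'" "int n"] by auto
  then show False using s \<open>n \<ge> 3\<close> by simp
qed

lemma torus_adj_sym: "torus_adj n d x y \<Longrightarrow> torus_adj n d y x"
proof -
  have 1: "[a = b - 1] (mod int n)" if "[b = a + 1] (mod int n)" for a b
    using cong_sym[OF cong_diff[OF that cong_refl[of 1]]] by simp
  have 2: "[a = b + 1] (mod int n)" if "[b = a - 1] (mod int n)" for a b
    using cong_sym[OF cong_add[OF that cong_refl[of 1]]] by simp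
  assume "torus_adj n d x y"
  then show ?thesis unfolding torus_adj_def by (metis 1 2)
qed

lemma edges_torus:
  "{x, y} \<in> edges (torus n d) \<longleftrightarrow> x \<in> grid n d \<and> y \<in> grid n d \<and> torus_adj n d x y"
  by (auto simp: torus_def grid_def Let_def doubleton_eq_iff dest: torus_adj_sym)

lemma torus_adj_iff_coord_shift:
  assumes n: "n \<ge> 2" and x: "x \<in> grid n d" and y: "y \<in> grid n d"
  shows "torus_adj n d x y \<longleftrightarrow> (\<exists>i<d. \<exists>s\<in>steps n. y = coord_shift n i s x)"
proof
  assume "torus_adj n d x y"
  then obtain i where i: "i < d" "x i \<noteq> y i"
    "[y i = x i + 1] (mod int n) \<or> [y i = x i - 1] (mod int n)"
    and eq: "\<And>j. j < d \<Longrightarrow> j \<noteq> i \<Longrightarrow> y j = x j"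
    unfolding torus_adj_def by blast
  have yi: "y i mod int n = y i" using grid_memD[OF y i(1)] by simp
  have "\<exists>s\<in>steps n. y i = (x i + s) mod int n"
  proof (cases "n = 2")
    case True
    have "(x i - 1) mod 2 = (x i + 1) mod 2" by presburger
    then show ?thesis using i(3) yi True by (auto simp: steps_def cong_def)
  next
    case False
    then show ?thesis using i(3) yi by (auto simp: steps_def cong_def)
  qed
  then obtain s where s: "s \<in> steps n" "y i = (x i + s) mod int n" by blast
  have "y = coord_shift n i s x"
  proof
    fix j
    show "y j = coord_shift n i s x j"
      using s(2) eq[of j] x y by (cases "j < d") (auto simp: coord_shift_def grid_def PiE_iff extensional_def)
  qed
  with i s show "\<exists>i<d. \<exists>s\<in>steps n. y = coord_shift n i s x" by blast
next
  assume "\<exists>i<d. \<exists>s\<in>steps n. y = coord_shift n i s x"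
  then obtain i s where i: "i < d" and s: "s \<in> steps n" and y: "y = coord_shift n i s x" by blast
  have "y i = (x i + s) mod int n" by (simp add: y coord_shift_def)
  moreover have "x i \<noteq> (x i + s) mod int n" using mod_add_step_neq[OF n s] by metis
  moreover have "s = 1 \<or> s = -1" using s by (auto simp: steps_def split: if_splits)
  ultimately have "x i \<noteq> y i \<and> ([y i = x i + 1] (mod int n) \<or> [y i = x i - 1] (mod int n))"
    by (auto simp: cong_def)
  moreover have "\<forall>j<d. j \<noteq> i \<longrightarrow> y j = x j" by (simp add: y coord_shift_def)
  ultimately show "torus_adj n d x y" unfolding torus_adj_def using i by blast
qed

lemma torus_neighbours:
  assumes "n \<ge> 2" "x \<in> grid n d"
  shows "{y \<in> grid n d. {x, y} \<in> edges (torus n d)} = (\<lambda>(i, s). coord_shift n i s x) ` ({..<d} \<times> steps n)"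
  using assms torus_adj_iff_coord_shift[OF assms] coord_shift_in_grid[of n x d]
  by (auto simp: edges_torus image_iff Bex_def split_paired_Ex)

lemma inj_on_coord_shift:
  assumes "n \<ge> 2"
  shows "inj_on (\<lambda>(i, s). coord_shift n i s x) ({..<d} \<times> steps n)"
proof (rule inj_onI, clarify)
  fix i s j t
  assume *: "s \<in> steps n" "t \<in> steps n" and eq: "coord_shift n i s x = coord_shift n j t x"
  have ij: "i = j"
  proof (rule ccontr)
    assume "i \<noteq> j"
    then have "(x i + s) mod int n = x i" using fun_cong[OF eq, of i] by (simp add: coord_shift_def)
    then show False using mod_add_step_neq[OF assms *(1)] by blast
  qed
  moreover have "(x i + s) mod int n = (x i + t) mod int n"
    using fun_cong[OF eq, of i] ij by (simp add: coord_shift_def)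
  ultimately show "i = j \<and> s = t" using mod_add_step_inj[OF assms *] by blast
qed

lemma vertex_degree_torus:
  assumes "n \<ge> 2" "x \<in> grid n d"
  shows "vertex_degree (torus n d) x = d * card (steps n)"
  unfolding vertex_degree_def verts_torus torus_neighbours[OF assms]
  by (simp add: card_image[OF inj_on_coord_shift[OF assms(1)]] card_cartesian_product)

text \<open>The edge-set description of the walk, rewritten as an average over a coordinate and a step. Row
sums, the Dirichlet form and the action on functions of one coordinate are read off from it.\<close>

lemma torus_walk_sum:
  assumes n: "n \<ge> 2" and x: "x \<in> grid n d"
  shows "(\<Sum>y\<in>grid n d. lazy_walk (torus n d) x y * h y)
    = h x / 2 + (\<Sum>i<d. \<Sum>s\<in>steps n. h (coord_shift n i s x)) / (2 * real (d * card (steps n)))"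
proof -
  define c where "c = 1 / (2 * real (d * card (steps n)))"
  let ?E = "{y \<in> grid n d. {x, y} \<in> edges (torus n d)}"
  have not_self: "x \<notin> ?E"
    by (auto simp: edges_torus torus_adj_def)
  have fin: "finite ?E" by simp
  have "(\<Sum>y\<in>grid n d. lazy_walk (torus n d) x y * h y)
      = (\<Sum>y\<in>insert x ?E. lazy_walk (torus n d) x y * h y)"
    using x by (intro sum.mono_neutral_right) (auto simp: lazy_walk_def)
  also have "\<dots> = h x / 2 + (\<Sum>y\<in>?E. lazy_walk (torus n d) x y * h y)"
    using not_self fin by (subst sum.insert) (auto simp: lazy_walk_def)
  also have "(\<Sum>y\<in>?E. lazy_walk (torus n d) x y * h y) = (\<Sum>y\<in>?E. c * h y)"
    using not_self by (intro sum.cong refl)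
      (auto simp: lazy_walk_def vertex_degree_torus[OF n x] c_def)
  also have "\<dots> = c * (\<Sum>i<d. \<Sum>s\<in>steps n. h (coord_shift n i s x))"
    unfolding torus_neighbours[OF n x] sum.reindex[OF inj_on_coord_shift[OF n]]
    by (simp add: sum.cartesian_product sum_distrib_left case_prod_unfold)
  finally show ?thesis by (simp add: c_def)
qed

lemma lazy_symmetric_chain_torus:
  assumes n: "n \<ge> 2" and d: "d \<ge> 1"
  shows "lazy_symmetric_chain (grid n d) (lazy_walk (torus n d))"
proof
  show "grid n d \<noteq> {}" using n by (auto simp: grid_def PiE_eq_empty_iff)
  show "lazy_walk (torus n d) x y = lazy_walk (torus n d) y x" if "x \<in> grid n d" "y \<in> grid n d" for x y
    using that by (auto simp: lazy_walk_def vertex_degree_torus[OF n] insert_commute)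
  show "(\<Sum>y\<in>grid n d. lazy_walk (torus n d) x y) = 1" if "x \<in> grid n d" for x
    using torus_walk_sum[OF n that, of "\<lambda>_. 1"] d by (simp add: steps_def split: if_splits)
qed (auto simp: lazy_walk_def)

text \<open>A move in a given direction has probability at least \<open>1/(4d)\<close>, so the energy of the grid is at most \<open>8d\<close>
times the Dirichlet form. With the constant \<open>2n\<^sup>2\<close> of the grid this gives \<open>16 d n\<^sup>2\<close>.\<close>

lemma log_Sobolev_chain_torus:
  assumes n: "n \<ge> 2" and d: "d \<ge> 1"
  shows "log_Sobolev_chain (grid n d) (lazy_walk (torus n d)) (16 * real d * (real n)\<^sup>2)"
proof -
  interpret lazy_symmetric_chain "grid n d" "lazy_walk (torus n d)"
    by (rule lazy_symmetric_chain_torus[OF assms])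
  have energy: "grid_energy n d f \<le> 8 * real d * dirichlet f" for f
  proof -
    define \<sigma> where "\<sigma> = real (card (steps n))"
    have \<sigma>: "0 < \<sigma>" "\<sigma> \<le> 2" using card_steps[of n] by (auto simp: \<sigma>_def)
    have "grid_energy n d f = (\<Sum>x\<in>grid n d. \<Sum>i<d. if x i + 1 < int n then (f (x(i := x i + 1)) - f x)\<^sup>2 else 0)"
      unfolding grid_energy_def by (rule sum.swap)
    also have "\<dots> \<le> (\<Sum>x\<in>grid n d. \<Sum>i<d. \<Sum>s\<in>steps n. (f x - f (coord_shift n i s x))\<^sup>2)"
    proof (intro sum_mono)
      fix x i assume x: "x \<in> grid n d" and i: "i \<in> {..<d}"
      have "(if x i + 1 < int n then (f (x(i := x i + 1)) - f x)\<^sup>2 else 0) \<le> (f x - f (coord_shift n i 1 x))\<^sup>2"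
        using grid_memD[OF x, of i] i by (simp add: coord_shift_def power2_commute)
      also have "\<dots> \<le> (\<Sum>s\<in>steps n. (f x - f (coord_shift n i s x))\<^sup>2)"
        by (rule member_le_sum) (auto simp: steps_def)
      finally show "(if x i + 1 < int n then (f (x(i := x i + 1)) - f x)\<^sup>2 else 0)
        \<le> (\<Sum>s\<in>steps n. (f x - f (coord_shift n i s x))\<^sup>2)" .
    qed
    also have "\<dots> = 4 * (real d * \<sigma>) * dirichlet f"
      using d \<sigma> unfolding dirichlet_def
      by (simp add: torus_walk_sum[OF n] sum_divide_distrib[symmetric] \<sigma>_def)
    also have "\<dots> \<le> 4 * (real d * 2) * dirichlet f"
      using \<sigma> dirichlet_nonneg by (intro mult_right_mono mult_left_mono) auto
    finally show ?thesis by simp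
  qed
  show ?thesis
  proof
    have "1 \<le> (real n)\<^sup>2" using n by (intro one_le_power) simp
    then have "1 * 1 \<le> real d * (real n)\<^sup>2" using d by (intro mult_mono) auto
    then show "1 \<le> 16 * real d * (real n)\<^sup>2" by simp
    fix f
    have "entropy (grid n d) (\<lambda>x. (f x)\<^sup>2) \<le> 2 * (real n)\<^sup>2 * grid_energy n d f"
      using n by (intro log_Sobolev_grid) simp
    also have "\<dots> \<le> 2 * (real n)\<^sup>2 * (8 * real d * dirichlet f)"
      by (intro mult_left_mono energy) simp
    finally show "entropy (grid n d) (\<lambda>x. (f x)\<^sup>2) \<le> 16 * real d * (real n)\<^sup>2 * dirichlet f"
      by (simp add: mult_ac)
  qed
qed

section \<open>Fourier expansion of the lamplighter chain\<close>

text \<open>The nontrivial character of \<open>\<int>\<^sub>2\<close>; products over \<open>S\<close> then give all the characters of the group of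
lamp configurations.\<close>

definition sign :: "2 \<Rightarrow> real" where
  "sign a = (if a = 0 then 1 else - 1)"

definition character :: "'a set \<Rightarrow> ('a \<Rightarrow> 2) \<Rightarrow> real" where
  "character S f = (\<Prod>v\<in>S. sign (f v))"

lemma UNIV_bits: "(UNIV :: 2 set) = {0, 1}"
  by (rule card_subset_eq[symmetric]) auto

lemma bit_cases: "a = 0 \<or> a = (1 :: 2)"
  using UNIV_I[of a] unfolding UNIV_bits by simp

lemma sum_bits: "(\<Sum>a\<in>UNIV. h a) = h (0::2) + h 1"
  unfolding UNIV_bits by simp

lemma sum_character_update:
  assumes "finite S"
  shows "(\<Sum>a\<in>UNIV. character S (f(y := a))) = (if y \<in> S then 0 else 2 * character S f)"
proof -
  have 1: "character S (f(y := a)) = sign a * character (S - {y}) f" if "y \<in> S" for a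
    unfolding character_def using assms that
    by (subst prod.remove[of S y]) (auto intro!: prod.cong)
  have 2: "character S (f(y := a)) = character S f" if "y \<notin> S" for a
    unfolding character_def using that by (intro prod.cong) auto
  show ?thesis by (simp add: sum_bits 1 2 sign_def)
qed

lemma sum_character_update2:
  assumes "finite S"
  shows "(\<Sum>a\<in>UNIV. \<Sum>b\<in>UNIV. character S (f(x := a, y := b)))
    = (if x \<in> S \<or> y \<in> S then 0 else 4 * character S f)"
  using sum_character_update[OF assms, of f x]
  by (cases "y \<in> S") (simp_all add: sum_character_update[OF assms] sum_distrib_left[symmetric])

lemma abs_character [simp]: "\<bar>character S f\<bar> = 1"
  by (simp add: character_def abs_prod sign_def if_distrib cong: if_cong)

text \<open>Orthogonality of characters. The sum over all subsets of \<open>V\<close> factorises into a product over \<open>V\<close>, with a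
vanishing factor at each point where the configurations differ.\<close>

lemma sum_character_product:
  assumes "finite V" "f \<in> V \<rightarrow>\<^sub>E UNIV" "g \<in> V \<rightarrow>\<^sub>E UNIV"
  shows "(\<Sum>S\<in>Pow V. character S f * character S g) = (if f = g then 2 ^ card V else 0)"
proof -
  have "(\<Sum>S\<in>Pow V. character S f * character S g)
      = (\<Sum>S\<in>Pow V. (\<Prod>v\<in>S. sign (f v) * sign (g v)) * (\<Prod>v\<in>V - S. 1))"
    by (simp add: character_def prod.distrib)
  also have "\<dots> = (\<Prod>v\<in>V. sign (f v) * sign (g v) + 1)"
    by (rule prod_add[OF assms(1), symmetric])
  also have "\<dots> = (if f = g then 2 ^ card V else 0)"
  proof (cases "f = g")
    case True
    have "(\<Prod>v\<in>V. sign (g v) * sign (g v) + 1) = (\<Prod>v\<in>V. 2)"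
      by (intro prod.cong) (auto simp: sign_def)
    then show ?thesis using True by simp
  next
    case False
    then obtain v where v: "f v \<noteq> g v" by auto
    then have "v \<in> V" using assms(2,3) PiE_arb[of f V] PiE_arb[of g V] by (metis)
    moreover have "sign (f v) * sign (g v) + 1 = 0"
      using v bit_cases[of "f v"] bit_cases[of "g v"] by (auto simp: sign_def)
    ultimately show ?thesis using False assms(1) by (auto simp: prod_zero_iff)
  qed
  finally show ?thesis .
qed

lemma prob_two_bits:
  "measure_pmf.prob (pair_pmf (pmf_of_set UNIV) (pmf_of_set UNIV)) {(a, b). R a b}
    = (\<Sum>a\<in>UNIV. \<Sum>b\<in>UNIV. if R (a::2) (b::2) then 1 / 4 else 0)"
proof -
  have fin: "finite (UNIV :: (2 \<times> 2) set)" by simp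
  have "measure_pmf.prob (pair_pmf (pmf_of_set UNIV) (pmf_of_set UNIV)) {(a, b). R a b}
      = (\<Sum>p\<in>{(a, b). R a b}. 1 / 4)"
    by (subst measure_measure_pmf_finite) (auto simp: pmf_pair simp del: sum_constant intro!: sum.cong)
  also have "\<dots> = (\<Sum>p\<in>UNIV. if (case p of (a, b) \<Rightarrow> R a b) then 1 / 4 else 0)"
    by (simp add: sum.If_cases[OF fin])
  also have "\<dots> = (\<Sum>a\<in>UNIV. \<Sum>b\<in>UNIV. if R a b then 1 / 4 else 0)"
    by (simp add: UNIV_Times_UNIV[symmetric] sum.cartesian_product case_prod_unfold del: UNIV_Times_UNIV)
  finally show ?thesis .
qed

lemma finite_lamplighter_states [simp]: "finite (verts G) \<Longrightarrow> finite (lamplighter_states G)"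
  by (simp add: lamplighter_states_def finite_PiE)

lemma lamplighter_step_sum:
  assumes fin: "finite (verts G)" and f: "f \<in> verts G \<rightarrow>\<^sub>E UNIV" and x: "x \<in> verts G"
  shows "(\<Sum>s\<in>lamplighter_states G. lamplighter_walk G (f, x) s * \<psi> s)
    = (\<Sum>y\<in>verts G. lazy_walk G x y * ((\<Sum>a\<in>UNIV. \<Sum>b\<in>UNIV. \<psi> (f(x := a, y := b), y)) / 4))"
proof -
  let ?\<Omega> = "verts G \<rightarrow>\<^sub>E (UNIV :: 2 set)"
  have \<Omega>: "finite ?\<Omega>" by (simp add: finite_PiE fin)
  have "(\<Sum>s\<in>lamplighter_states G. lamplighter_walk G (f, x) s * \<psi> s)
      = (\<Sum>y\<in>verts G. \<Sum>g\<in>?\<Omega>. lamplighter_walk G (f, x) (g, y) * \<psi> (g, y))"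
    unfolding lamplighter_states_def by (subst sum.swap) (simp add: sum.cartesian_product)
  also have "\<dots> = (\<Sum>y\<in>verts G. lazy_walk G x y * ((\<Sum>a\<in>UNIV. \<Sum>b\<in>UNIV. \<psi> (f(x := a, y := b), y)) / 4))"
  proof (rule sum.cong[OF refl])
    fix y assume y: "y \<in> verts G"
    have mem: "f(x := a, y := b) \<in> ?\<Omega>" for a b
      using f x y by (auto simp: PiE_iff extensional_def)
    have "(\<Sum>g\<in>?\<Omega>. lamplighter_walk G (f, x) (g, y) * \<psi> (g, y))
        = (\<Sum>g\<in>?\<Omega>. \<Sum>a\<in>UNIV. \<Sum>b\<in>UNIV. if f(x := a, y := b) = g then lazy_walk G x y * \<psi> (g, y) / 4 else 0)"
      unfolding lamplighter_walk_def prod.case prob_two_bits sum_distrib_left sum_distrib_right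
      by (intro sum.cong refl) simp
    also have "\<dots> = (\<Sum>a\<in>UNIV. \<Sum>b\<in>UNIV. \<Sum>g\<in>?\<Omega>. if f(x := a, y := b) = g then lazy_walk G x y * \<psi> (g, y) / 4 else 0)"
      by (subst sum.swap, intro sum.cong refl, rule sum.swap)
    also have "\<dots> = (\<Sum>a\<in>UNIV. \<Sum>b\<in>UNIV. lazy_walk G x y * \<psi> (f(x := a, y := b), y) / 4)"
      using \<Omega> mem by simp
    finally show "(\<Sum>g\<in>?\<Omega>. lamplighter_walk G (f, x) (g, y) * \<psi> (g, y))
        = lazy_walk G x y * ((\<Sum>a\<in>UNIV. \<Sum>b\<in>UNIV. \<psi> (f(x := a, y := b), y)) / 4)"
      by (simp add: sum_distrib_left sum_divide_distrib)
  qed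
  finally show ?thesis .
qed

lemma matrix_power_Suc_left:
  assumes "finite V" "x \<in> V" "y \<in> V"
  shows "matrix_power V Q (Suc t) x y = (\<Sum>z\<in>V. Q x z * matrix_power V Q t z y)"
  using assms(2,3)
proof (induction t arbitrary: y)
  case 0
  then show ?case using assms(1) by (simp add: if_distrib[of "\<lambda>a. a * _"] if_distrib[of "\<lambda>a. _ * a"] cong: if_cong)
next
  case (Suc t)
  have "matrix_power V Q (Suc (Suc t)) x y = (\<Sum>w\<in>V. (\<Sum>z\<in>V. Q x z * matrix_power V Q t z w) * Q w y)"
    unfolding matrix_power.simps(2)[of V Q "Suc t"] using Suc.IH[OF Suc.prems(1)] by simp
  also have "\<dots> = (\<Sum>z\<in>V. \<Sum>w\<in>V. Q x z * (matrix_power V Q t z w * Q w y))"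
    unfolding sum_distrib_right by (subst sum.swap) (simp add: mult.assoc)
  also have "\<dots> = (\<Sum>z\<in>V. Q x z * matrix_power V Q (Suc t) z y)"
    by (simp add: sum_distrib_left)
  finally show ?case .
qed

text \<open>For \<open>t \<ge> 1\<close> this is, up to the sign \<open>character S g\<close>, the probability that the walk from \<open>x\<close> is at \<open>y\<close> at
time \<open>t\<close> without having visited \<open>S\<close>.\<close>

definition character_coefficient :: "'a graph \<Rightarrow> nat \<Rightarrow> ('a \<Rightarrow> 2) \<Rightarrow> 'a \<Rightarrow> 'a set \<Rightarrow> 'a \<Rightarrow> real" where
  "character_coefficient G t g y S = (lazy_symmetric_chain.killed (verts G) (lazy_walk G) S ^^ t)
     (\<lambda>z. if z = y then character S g else 0)"

text \<open>Refreshing the lamps at the two ends of a step averages a character to zero if one of the ends lies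
in \<open>S\<close> and leaves it alone otherwise. So the characters block-diagonalise the lamplighter chain, and
the block of \<open>S\<close> is the walk killed on \<open>S\<close>. The initial condition is the orthogonality relation.\<close>

lemma lamplighter_power_eq_character_sum:
  assumes chain: "lazy_symmetric_chain (verts G) (lazy_walk G)"
    and "(f, x) \<in> lamplighter_states G" and gy: "(g, y) \<in> lamplighter_states G"
  shows "matrix_power (lamplighter_states G) (lamplighter_walk G) t (f, x) (g, y)
    = (\<Sum>S\<in>Pow (verts G). character S f * character_coefficient G t g y S x) / 2 ^ card (verts G)"
  using assms(2)
proof (induction t arbitrary: f x)
  interpret lazy_symmetric_chain "verts G" "lazy_walk G" by fact
  case 0
  then have "(\<Sum>S\<in>Pow (verts G). character S f * character S g) = (if f = g then 2 ^ card (verts G) else 0)"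
    using gy by (intro sum_character_product) (auto simp: finite_V lamplighter_states_def)
  then show ?case by (cases "x = y") (auto simp: character_coefficient_def)
next
  interpret lazy_symmetric_chain "verts G" "lazy_walk G" by fact
  case (Suc t)
  let ?V = "verts G" and ?N = "2 ^ card (verts G) :: real"
  let ?Q = "matrix_power (lamplighter_states G) (lamplighter_walk G)"
  have f: "f \<in> ?V \<rightarrow>\<^sub>E UNIV" and x: "x \<in> ?V"
    using Suc.prems by (auto simp: lamplighter_states_def)
  have avg: "(\<Sum>a\<in>UNIV. \<Sum>b\<in>UNIV. ?Q t (f(x := a, z := b), z) (g, y))
      = (\<Sum>S\<in>Pow ?V. 4 * (if x \<in> S \<or> z \<in> S then 0 else character S f * character_coefficient G t g y S z)) / ?N"
    if z: "z \<in> ?V" for z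
  proof -
    have mem: "(f(x := a, z := b), z) \<in> lamplighter_states G" for a b
      using f x z by (auto simp: lamplighter_states_def PiE_iff extensional_def)
    have "(\<Sum>a\<in>UNIV. \<Sum>b\<in>UNIV. ?Q t (f(x := a, z := b), z) (g, y))
        = (\<Sum>a\<in>UNIV. \<Sum>b\<in>UNIV. \<Sum>S\<in>Pow ?V. character S (f(x := a, z := b)) * character_coefficient G t g y S z) / ?N"
      unfolding Suc.IH[OF mem] by (simp add: sum_divide_distrib)
    also have "(\<Sum>a\<in>UNIV. \<Sum>b\<in>UNIV. \<Sum>S\<in>Pow ?V. character S (f(x := a, z := b)) * character_coefficient G t g y S z)
        = (\<Sum>S\<in>Pow ?V. (\<Sum>a\<in>UNIV. \<Sum>b\<in>UNIV. character S (f(x := a, z := b))) * character_coefficient G t g y S z)"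
      by (simp add: sum_bits sum.distrib distrib_right)
    also have "\<dots> = (\<Sum>S\<in>Pow ?V. 4 * (if x \<in> S \<or> z \<in> S then 0 else character S f * character_coefficient G t g y S z))"
      using finite_V by (intro sum.cong refl) (auto simp: sum_character_update2 finite_subset)
    finally show ?thesis .
  qed
  have "?Q (Suc t) (f, x) (g, y) = (\<Sum>s\<in>lamplighter_states G. lamplighter_walk G (f, x) s * ?Q t s (g, y))"
    using finite_V Suc.prems gy by (intro matrix_power_Suc_left) auto
  also have "\<dots> = (\<Sum>z\<in>?V. lazy_walk G x z * ((\<Sum>a\<in>UNIV. \<Sum>b\<in>UNIV. ?Q t (f(x := a, z := b), z) (g, y)) / 4))"
    by (rule lamplighter_step_sum[OF finite_V f x])
  also have "\<dots> = (\<Sum>z\<in>?V. \<Sum>S\<in>Pow ?V. lazy_walk G x z * (if x \<in> S \<or> z \<in> S then 0 else character S f * character_coefficient G t g y S z)) / ?N"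
    by (simp add: avg sum_distrib_left sum_divide_distrib)
  also have "\<dots> = (\<Sum>S\<in>Pow ?V. \<Sum>z\<in>?V. lazy_walk G x z * (if x \<in> S \<or> z \<in> S then 0 else character S f * character_coefficient G t g y S z)) / ?N"
    by (subst sum.swap) simp
  also have "\<dots> = (\<Sum>S\<in>Pow ?V. character S f * character_coefficient G (Suc t) g y S x) / ?N"
  proof -
    have "(\<Sum>z\<in>?V. lazy_walk G x z * (if x \<in> S \<or> z \<in> S then 0 else character S f * character_coefficient G t g y S z))
        = character S f * character_coefficient G (Suc t) g y S x" for S
    proof (cases "x \<in> S")
      case True
      then show ?thesis by (simp add: character_coefficient_def killed_def)
    next
      case False
      have "(\<Sum>z\<in>?V. lazy_walk G x z * (if x \<in> S \<or> z \<in> S then 0 else character S f * character_coefficient G t g y S z))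
          = (\<Sum>z\<in>?V - S. character S f * (lazy_walk G x z * character_coefficient G t g y S z))"
        using False by (intro sum.mono_neutral_cong_right) (auto simp: finite_V)
      then show ?thesis
        using False by (simp add: character_coefficient_def killed_def sum_distrib_left)
    qed
    then show ?thesis by simp
  qed
  finally show ?case .
qed

section \<open>Upper bound on the mixing time\<close>

text \<open>Keep only the \<open>k\<close>-th term of the binomial expansion of \<open>(1 + k/N)\<^sup>N \<le> e\<^sup>k\<close>.\<close>

lemma binomial_le_exp:
  assumes "1 \<le> k" "k \<le> N"
  shows "real (N choose k) \<le> exp (real k * (1 + ln (real N / real k)))"
proof -
  define q where "q = real k / real N"
  have q: "q > 0" using assms by (simp add: q_def)
  have "real (N choose k) * q ^ k \<le> (\<Sum>j\<le>N. real (N choose j) * q ^ j)"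
    using assms q by (intro member_le_sum[where f = "\<lambda>j. real (N choose j) * q ^ j"]) auto
  also have "\<dots> = (q + 1) ^ N" by (simp add: binomial_ring)
  also have "\<dots> \<le> exp q ^ N"
    using q by (intro power_mono) (auto simp: add.commute exp_ge_add_one_self)
  also have "\<dots> = exp (real k)" using assms by (simp add: exp_of_nat_mult[symmetric] q_def)
  finally have "real (N choose k) \<le> exp (real k) / q ^ k" using q by (simp add: field_simps)
  also have "\<dots> = exp (real k * (1 + ln (real N / real k)))"
  proof -
    have "exp (real k * ln (real N / real k)) = (real N / real k) ^ k"
      using assms by (simp add: exp_of_nat_mult)
    then show ?thesis
      using assms by (simp add: q_def distrib_left exp_add power_divide)
  qed
  finally show ?thesis .
qed

lemma sum_geometric_le: "(\<Sum>k = 1..N. (1 / 16 :: real) ^ k) \<le> 1 / 15"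
proof -
  have "(\<Sum>k = 1..N. (1 / 16 :: real) ^ k) = (1 - (1 / 16) ^ N) / 15"
  proof (induction N)
    case (Suc N)
    have "(\<Sum>k = 1..Suc N. (1 / 16 :: real) ^ k) = (\<Sum>k = 1..N. (1 / 16) ^ k) + (1 / 16) ^ Suc N"
      by simp
    also have "\<dots> = (1 - (1 / 16) ^ Suc N) / 15"
      unfolding Suc.IH by (simp add: field_simps)
    finally show ?case .
  qed simp
  then show ?thesis by simp
qed

text \<open>Write \<open>e(k) = k (1 + ln (N/k))\<close>. There are at most \<open>exp e(k)\<close> sets of size \<open>k\<close>, and \<open>e(k)\<close> is at least \<open>k\<close> and at
least \<open>ln N\<close>. Of the six copies of \<open>e(k)\<close> in the exponent, one pays for the number of sets, one for the
factor \<open>1/N\<close>, and four leave a geometric series.\<close>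

lemma sum_subsets_exp_le:
  assumes "finite V" "V \<noteq> {}"
  shows "(\<Sum>S\<in>Pow V - {{}}. exp (- (6 * (real (card S) * (1 + ln (real (card V) / real (card S)))))))
    \<le> 1 / (15 * real (card V))"
proof -
  define N where "N = card V"
  define e where "e k = real k * (1 + ln (real N / real k))" for k
  have N: "N \<ge> 1" using assms by (simp add: N_def Suc_le_eq card_gt_0_iff)
  have "(\<Sum>S\<in>Pow V - {{}}. exp (- (6 * e (card S))))
      = (\<Sum>k = 1..N. \<Sum>S\<in>{S \<in> Pow V - {{}}. card S = k}. exp (- (6 * e (card S))))"
    using assms(1) by (intro sum.group[symmetric])
      (auto simp: N_def Suc_le_eq card_gt_0_iff finite_subset card_mono)
  also have "\<dots> = (\<Sum>k = 1..N. real (N choose k) * exp (- (6 * e k)))"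
  proof (rule sum.cong[OF refl])
    fix k assume "k \<in> {1..N}"
    then have "{S \<in> Pow V - {{}}. card S = k} = {S. S \<subseteq> V \<and> card S = k}" by auto
    then have "card {S \<in> Pow V - {{}}. card S = k} = N choose k"
      by (simp add: n_subsets[OF assms(1)] N_def)
    then show "(\<Sum>S\<in>{S \<in> Pow V - {{}}. card S = k}. exp (- (6 * e (card S))))
        = real (N choose k) * exp (- (6 * e k))" by simp
  qed
  also have "\<dots> \<le> (\<Sum>k = 1..N. (1 / 16) ^ k * (1 / real N))"
  proof (rule sum_mono)
    fix k assume "k \<in> {1..N}"
    then have k: "1 \<le> k" "k \<le> N" by auto
    have ln: "0 \<le> ln (real N / real k)" using k by simp
    have e1: "real k \<le> e k" using k ln by (simp add: e_def)
    have e2: "ln (real N) \<le> e k"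
    proof -
      have "ln (real N) = ln (real N / real k) + ln (real k)" using k by (simp add: ln_div)
      also have "ln (real k) \<le> real k" using ln_le_minus_one[of "real k"] k by simp
      also have "ln (real N / real k) \<le> real k * ln (real N / real k)"
        using mult_right_mono[of 1 "real k", OF _ ln] k by simp
      finally show ?thesis by (simp add: e_def distrib_left)
    qed
    have "real (N choose k) * exp (- (6 * e k)) \<le> exp (e k) * exp (- (6 * e k))"
      using binomial_le_exp[OF k] by (intro mult_right_mono) (auto simp: e_def)
    also have "\<dots> \<le> exp (- (4 * real k) - ln (real N))"
      unfolding exp_add[symmetric] using e1 e2 by simp
    also have "\<dots> = exp (- 4) ^ k * (1 / real N)"
      using N by (simp add: exp_diff exp_of_nat_mult[symmetric] mult.commute)
    also have "\<dots> \<le> (1 / 16) ^ k * (1 / real N)"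
    proof (intro mult_right_mono power_mono)
      have "(2 :: real) ^ 4 \<le> exp 1 ^ 4" using exp_ge_add_one_self[of 1] by (intro power_mono) auto
      also have "\<dots> = exp 4" by (simp add: exp_of_nat_mult[symmetric])
      finally show "exp (- 4 :: real) \<le> 1 / 16" by (simp add: exp_minus field_simps)
    qed auto
    finally show "real (N choose k) * exp (- (6 * e k)) \<le> (1 / 16) ^ k * (1 / real N)" .
  qed
  also have "\<dots> \<le> 1 / 15 * (1 / real N)"
    unfolding sum_distrib_right[symmetric] by (intro mult_right_mono sum_geometric_le) simp
  finally show ?thesis by (simp add: e_def N_def)
qed

lemma abs_le_exp_half:
  fixes z :: real
  assumes "z\<^sup>2 \<le> exp (- a)"
  shows "\<bar>z\<bar> \<le> exp (- (a / 2))"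
proof -
  have "z\<^sup>2 \<le> (exp (- (a / 2)))\<^sup>2" using assms by (simp add: exp_double[symmetric])
  then have "\<bar>z\<bar> \<le> \<bar>exp (- (a / 2))\<bar>" by (simp only: abs_le_square_iff)
  then show ?thesis by simp
qed

lemma one_minus_power_le_exp:
  fixes u :: real
  assumes "u \<le> 1"
  shows "(1 - u) ^ t \<le> exp (- (u * real t))"
proof -
  have "(1 - u) ^ t \<le> exp (- u) ^ t"
    using assms exp_ge_add_one_self[of "- u"] by (intro power_mono) auto
  then show ?thesis by (simp add: exp_of_nat_mult[symmetric] mult.commute)
qed

text \<open>By symmetry a stationary distribution is harmonic, so its Dirichlet form is zero, and the Poincare
inequality leaves only constants.\<close>

lemma (in log_Sobolev_chain) stationary_distribution_eq:
  assumes x: "x \<in> V"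
  shows "stationary_distribution V P x = 1 / real (card V)"
proof -
  define u where "u x = (if x \<in> V then 1 / real (card V) else 0)" for x
  have "is_stationary V P u"
    unfolding is_stationary_def
  proof (intro conjI ballI allI impI)
    show "(\<Sum>x\<in>V. u x) = 1" using card_V_pos by (simp add: u_def)
    show "(\<Sum>x\<in>V. u x * P x y) = u y" if "y \<in> V" for y
      using P_column[OF that] that by (simp add: u_def sum_divide_distrib[symmetric])
  qed (auto simp: u_def)
  moreover have "\<pi> = u" if st: "is_stationary V P \<pi>" for \<pi>
  proof
    fix x
    have "(\<Sum>y\<in>V. P x y * \<pi> y) = \<pi> x" if "x \<in> V" for x
    proof -
      have "(\<Sum>y\<in>V. P x y * \<pi> y) = (\<Sum>y\<in>V. \<pi> y * P y x)"
        by (intro sum.cong refl) (simp add: P_sym[OF that] mult.commute)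
      then show ?thesis using st that by (simp add: is_stationary_def)
    qed
    then have "dirichlet \<pi> = 0" by (simp add: dirichlet_eq power2_eq_square)
    then have "(\<Sum>x\<in>V. (\<pi> x - mean V \<pi>)\<^sup>2) \<le> 0" using Poincare[of \<pi>] by simp
    then have "(\<Sum>x\<in>V. (\<pi> x - mean V \<pi>)\<^sup>2) = 0" by (intro antisym sum_nonneg) auto
    then have "\<pi> x = mean V \<pi>" if "x \<in> V" for x
      using that finite_V by (simp add: sum_nonneg_eq_0_iff)
    moreover have "mean V \<pi> = 1 / real (card V)" and "x \<notin> V \<Longrightarrow> \<pi> x = 0"
      using st by (simp_all add: is_stationary_def mean_def)
    ultimately show "\<pi> x = u x" by (simp add: u_def)
  qed
  ultimately have "stationary_distribution V P = u"
    unfolding stationary_distribution_def by (rule the_equality)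
  then show ?thesis using x by (simp add: u_def)
qed

definition uniformly_mixed :: "'a graph \<Rightarrow> real \<Rightarrow> nat \<Rightarrow> bool" where
  "uniformly_mixed G \<epsilon> t \<longleftrightarrow> (\<forall>s\<in>lamplighter_states G. \<forall>s'\<in>lamplighter_states G.
     \<bar>matrix_power (lamplighter_states G) (lamplighter_walk G) t s s'
        - 1 / (real (card (verts G)) * 2 ^ card (verts G))\<bar>
     \<le> \<epsilon> / (real (card (verts G)) * 2 ^ card (verts G)))"

lemma t_u_eq:
  assumes "log_Sobolev_chain (verts G) (lazy_walk G) C"
  shows "t_u G = (LEAST t. uniformly_mixed G (1 / (2 * exp 1)) t)"
proof -
  interpret log_Sobolev_chain "verts G" "lazy_walk G" C by fact
  let ?St = "lamplighter_states G" and ?K = "real (card (verts G)) * 2 ^ card (verts G)"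
  have K: "?K > 0" using card_V_pos by simp
  have \<pi>: "lamplighter_stationary G s = 1 / ?K" if "s \<in> ?St" for s
  proof -
    have "snd s \<in> verts G" using that by (auto simp: lamplighter_states_def)
    then show ?thesis
      by (simp add: lamplighter_stationary_def case_prod_unfold stationary_distribution_eq)
  qed
  have "?St \<noteq> {}"
    using V_nonempty by (auto simp: lamplighter_states_def PiE_eq_empty_iff)
  then have "((MAX (x, y)\<in>?St \<times> ?St. \<bar>matrix_power ?St (lamplighter_walk G) t x y - lamplighter_stationary G y\<bar>
        / lamplighter_stationary G y) \<le> \<epsilon>)
      \<longleftrightarrow> (\<forall>x\<in>?St. \<forall>y\<in>?St. \<bar>matrix_power ?St (lamplighter_walk G) t x y - lamplighter_stationary G y\<bar>
        / lamplighter_stationary G y \<le> \<epsilon>)" for t \<epsilon>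
    using finite_V by (subst Max_le_iff) auto
  also have "\<dots> t \<epsilon> \<longleftrightarrow> uniformly_mixed G \<epsilon> t" for t \<epsilon>
  proof -
    have "\<bar>a - 1 / ?K\<bar> / (1 / ?K) \<le> \<epsilon> \<longleftrightarrow> \<bar>a - 1 / ?K\<bar> \<le> \<epsilon> / ?K" for a
      by (simp only: divide_divide_eq_right div_by_1 pos_le_divide_eq[OF K])
    then show ?thesis unfolding uniformly_mixed_def by (simp only: \<pi> cong: ball_cong)
  qed
  finally show ?thesis by (simp add: t_u_def uniform_mixing_time_def)
qed

text \<open>In the Fourier expansion the empty set contributes the transition probabilities of the walk on \<open>G\<close>,
which the Poincare inequality brings close to \<open>1/N\<close>. Every other set contributes at most the norm of a
killed semigroup. The factor \<open>60\<close> is chosen to make the exponent from \<open>killed_Poincare\<close>, which is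
\<open>e(k) t / (10 C N)\<close> after taking a square root, equal to the \<open>6 e(k)\<close> of the subset sum. The two
contributions are then at most \<open>1/(30 N)\<close> and \<open>1/(15 N)\<close>.\<close>

theorem uniformly_mixed_after:
  assumes "log_Sobolev_chain (verts G) (lazy_walk G) C"
    and t: "60 * C * real (card (verts G)) \<le> real t"
  shows "uniformly_mixed G (1 / 6) (Suc t)"
  unfolding uniformly_mixed_def
proof clarify
  interpret log_Sobolev_chain "verts G" "lazy_walk G" C by fact
  let ?V = "verts G"
  define N where "N = real (card ?V)"
  have N: "N \<ge> 1" using card_V_pos by (simp add: N_def)
  have C: "C > 0" using C_ge_1 by simp
  fix f x g y
  assume fx: "(f, x) \<in> lamplighter_states G" and gy: "(g, y) \<in> lamplighter_states G"
  have x: "x \<in> ?V" and y: "y \<in> ?V" using fx gy by (auto simp: lamplighter_states_def)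
  let ?T = "character_coefficient G (Suc t) g y"
  let ?a = "matrix_power (lamplighter_states G) (lamplighter_walk G) (Suc t) (f, x) (g, y)"
  have norm: "(\<Sum>x\<in>?V. (if x = y then a else 0)\<^sup>2) = a\<^sup>2" for a :: real
    using y finite_V by (simp add: if_distrib[of "\<lambda>a. a\<^sup>2"] cong: if_cong)
  have nonempty: "\<bar>?T S x\<bar> \<le> exp (- (6 * (real (card S) * (1 + ln (N / real (card S))))))"
    if S: "S \<in> Pow ?V - {{}}" for S
  proof -
    define \<theta> where "\<theta> = real (card S) * (1 + ln (N / real (card S))) / N"
    have k: "1 \<le> real (card S)" "real (card S) \<le> N"
      using S finite_V by (auto simp: N_def Suc_le_eq card_gt_0_iff finite_subset card_mono)
    have "1 + ln (N / real (card S)) \<le> N / real (card S)"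
      using ln_le_minus_one[of "N / real (card S)"] k by simp
    then have \<theta>1: "\<theta> \<le> 1" using k by (simp add: \<theta>_def field_simps)
    have \<theta>0: "\<theta> \<ge> 0" using k by (simp add: \<theta>_def)
    have "(?T S x)\<^sup>2 \<le> (\<Sum>x\<in>?V. (?T S x)\<^sup>2)"
      using x finite_V by (intro member_le_sum[where f = "\<lambda>x. (?T S x)\<^sup>2"]) auto
    also have "\<dots> \<le> (1 - \<theta> / (5 * C)) ^ t * (\<Sum>x\<in>?V. (if x = y then character S g else 0)\<^sup>2)"
      unfolding character_coefficient_def
    proof (rule killed_decay)
      fix f :: "'a \<Rightarrow> real" assume "\<And>x. x \<in> S \<Longrightarrow> f x = 0"
      then have "\<theta> * (\<Sum>x\<in>?V. (f x)\<^sup>2) \<le> 5 * C * dirichlet f"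
        unfolding \<theta>_def N_def using S by (intro killed_Poincare) auto
      then show "\<theta> / (5 * C) * (\<Sum>x\<in>?V. (f x)\<^sup>2) \<le> dirichlet f"
        using C by (simp add: field_simps)
    qed (use \<theta>1 C_ge_1 in \<open>simp add: field_simps\<close>)
    also have "\<dots> = (1 - \<theta> / (5 * C)) ^ t"
    proof -
      have "(character S g)\<^sup>2 = 1" by (metis abs_character power2_abs one_power2)
      then show ?thesis by (simp only: norm mult_1_right)
    qed
    also have "\<dots> \<le> exp (- (\<theta> / (5 * C) * real t))"
      using \<theta>1 C_ge_1 by (intro one_minus_power_le_exp) (simp add: field_simps)
    finally have "\<bar>?T S x\<bar> \<le> exp (- (\<theta> / (5 * C) * real t / 2))" by (rule abs_le_exp_half)
    also have "\<dots> \<le> exp (- (\<theta> / (5 * C) * (60 * C * N) / 2))"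
    proof -
      have "\<theta> / (5 * C) * (60 * C * N) \<le> \<theta> / (5 * C) * real t"
        using \<theta>0 C t by (intro mult_left_mono) (auto simp: N_def)
      then show ?thesis by simp
    qed
    also have "\<theta> / (5 * C) * (60 * C * N) / 2 = 6 * (real (card S) * (1 + ln (N / real (card S))))"
      using C N by (simp add: \<theta>_def)
    finally show ?thesis .
  qed
  have empty: "\<bar>?T {} x - 1 / N\<bar> \<le> 1 / (30 * N)"
  proof -
    let ?\<delta> = "\<lambda>z. if z = y then 1 else 0 :: real"
    have mean: "mean ?V ?\<delta> = 1 / N" using y finite_V by (simp add: mean_def N_def)
    have "(?T {} x - 1 / N)\<^sup>2 \<le> (\<Sum>x\<in>?V. (?T {} x - 1 / N)\<^sup>2)"
      using x finite_V by (intro member_le_sum[where f = "\<lambda>x. (?T {} x - 1 / N)\<^sup>2"]) auto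
    also have "\<dots> \<le> (1 - 1 / C) ^ Suc t * (\<Sum>x\<in>?V. (?\<delta> x - mean ?V ?\<delta>)\<^sup>2)"
    proof -
      have "(\<Sum>x\<in>?V. ((killed {} ^^ Suc t) ?\<delta> x - mean ?V ?\<delta>)\<^sup>2)
          \<le> (1 - 1 / C) ^ Suc t * (\<Sum>x\<in>?V. (?\<delta> x - mean ?V ?\<delta>)\<^sup>2)"
      proof (rule mean_decay)
        show "1 / C * (\<Sum>x\<in>?V. (f x - mean ?V f)\<^sup>2) \<le> dirichlet f" for f
          using Poincare[of f] C by (simp add: field_simps)
      qed (use C_ge_1 in simp)
      then show ?thesis by (simp add: character_coefficient_def character_def mean cong: if_cong)
    qed
    also have "\<dots> \<le> (1 - 1 / C) ^ Suc t * 1"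
    proof (rule mult_left_mono)
      show "(\<Sum>x\<in>?V. (?\<delta> x - mean ?V ?\<delta>)\<^sup>2) \<le> 1"
        unfolding sum_square_mean_eq[OF finite_V V_nonempty] norm by simp
    qed (use C_ge_1 in simp)
    also have "\<dots> \<le> exp (- (1 / C * real (Suc t)))"
      unfolding mult_1_right using C_ge_1 by (intro one_minus_power_le_exp) simp
    finally have "\<bar>?T {} x - 1 / N\<bar> \<le> exp (- (1 / C * real (Suc t) / 2))" by (rule abs_le_exp_half)
    also have "\<dots> \<le> exp (- (30 * N))"
    proof -
      have "30 * N = 1 / C * (60 * C * N) / 2" using C by simp
      also have "\<dots> \<le> 1 / C * real (Suc t) / 2"
        using t C by (intro divide_right_mono mult_left_mono) (auto simp: N_def)
      finally show ?thesis by simp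
    qed
    also have "\<dots> \<le> 1 / (30 * N)"
    proof -
      have "30 * N \<le> exp (30 * N)" using exp_ge_add_one_self[of "30 * N"] by linarith
      then have "1 / exp (30 * N) \<le> 1 / (30 * N)" using N by (intro divide_left_mono) auto
      then show ?thesis by (simp add: exp_minus inverse_eq_divide)
    qed
    finally show ?thesis .
  qed
  have "?a = (\<Sum>S\<in>Pow ?V. character S f * ?T S x) / 2 ^ card ?V"
    by (rule lamplighter_power_eq_character_sum[OF lazy_symmetric_chain_axioms fx gy])
  also have "(\<Sum>S\<in>Pow ?V. character S f * ?T S x)
      = ?T {} x + (\<Sum>S\<in>Pow ?V - {{}}. character S f * ?T S x)"
    by (subst sum.remove[of _ "{}"]) (auto simp: finite_V character_def)
  finally have a: "?a - 1 / (N * 2 ^ card ?V)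
      = ((?T {} x - 1 / N) + (\<Sum>S\<in>Pow ?V - {{}}. character S f * ?T S x)) / 2 ^ card ?V"
    by (simp add: field_simps)
  have "\<bar>(\<Sum>S\<in>Pow ?V - {{}}. character S f * ?T S x)\<bar> \<le> (\<Sum>S\<in>Pow ?V - {{}}. \<bar>?T S x\<bar>)"
    by (rule order_trans[OF sum_abs]) (simp add: abs_mult)
  also have "\<dots> \<le> 1 / (15 * N)"
    using sum_mono[OF nonempty] sum_subsets_exp_le[OF finite_V V_nonempty]
    unfolding N_def by (rule order_trans)
  finally have "\<bar>(?T {} x - 1 / N) + (\<Sum>S\<in>Pow ?V - {{}}. character S f * ?T S x)\<bar> \<le> 1 / (30 * N) + 1 / (15 * N)"
    using empty by linarith
  also have "\<dots> \<le> 1 / 6 / N" using N by (simp add: field_simps)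
  finally have le: "\<bar>(?T {} x - 1 / N) + (\<Sum>S\<in>Pow ?V - {{}}. character S f * ?T S x)\<bar> \<le> 1 / 6 / N" .
  have "\<bar>?a - 1 / (N * 2 ^ card ?V)\<bar> \<le> 1 / 6 / N / 2 ^ card ?V"
    unfolding a abs_divide power_abs abs_numeral by (rule divide_right_mono[OF le]) simp
  then show "\<bar>?a - 1 / (real (card ?V) * 2 ^ card ?V)\<bar> \<le> 1 / 6 / (real (card ?V) * 2 ^ card ?V)"
    by (simp only: N_def divide_divide_eq_left)
qed

section \<open>Lower bound on the mixing time\<close>

text \<open>While the walk stays in \<open>A\<close>, the lamps outside \<open>A\<close> keep their initial values. A subeigenfunction \<open>\<phi>\<close> of the walk
killed outside \<open>A\<close>, restricted to such configurations, is a subeigenfunction of the lamplighter chain and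
its expectation decays no faster than \<open>\<rho>\<^sup>t\<close>. In equilibrium, however, dark lamps outside \<open>A\<close> have
probability only \<open>2 ^ card A / 2 ^ card (verts G)\<close>.\<close>

theorem confined_survival_bound:
  assumes chain: "lazy_symmetric_chain (verts G) (lazy_walk G)"
    and A: "A \<subseteq> verts G"
    and \<phi>0: "\<And>x. x \<notin> A \<Longrightarrow> \<phi> x = 0" and \<phi>_nonneg: "\<And>x. x \<in> A \<Longrightarrow> 0 \<le> \<phi> x"
    and sub: "\<And>x. x \<in> A \<Longrightarrow> \<rho> * \<phi> x \<le> (\<Sum>y\<in>verts G. lazy_walk G x y * \<phi> y)"
    and \<rho>: "0 \<le> \<rho>"
    and z: "z \<in> A" "0 < \<phi> z" "\<And>x. x \<in> A \<Longrightarrow> \<phi> x \<le> \<phi> z"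
    and mixed: "uniformly_mixed G \<epsilon> t" and \<epsilon>: "0 \<le> \<epsilon>"
  shows "\<rho> ^ t \<le> (1 + \<epsilon>) * 2 ^ card A / 2 ^ card (verts G)"
proof -
  interpret lazy_symmetric_chain "verts G" "lazy_walk G" by fact
  let ?V = "verts G" and ?St = "lamplighter_states G" and ?Q = "lamplighter_walk G"
  define dark :: "('a \<Rightarrow> 2) \<Rightarrow> bool" where "dark g \<longleftrightarrow> (\<forall>v\<in>?V - A. g v = 0)" for g
  define F where "F s = (if dark (fst s) then \<phi> (snd s) else 0)" for s :: "('a \<Rightarrow> 2) \<times> 'a"
  have \<phi>: "0 \<le> \<phi> x" "\<phi> x \<le> \<phi> z" for x
    using \<phi>0[of x] \<phi>_nonneg[of x] z by (cases "x \<in> A"; simp)+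
  have F: "0 \<le> F s" for s using \<phi> by (simp add: F_def)
  have zV: "z \<in> ?V" using z A by blast
  have Q_nonneg: "0 \<le> ?Q s s'" if "s \<in> ?St" "s' \<in> ?St" for s s'
    using that P_nonneg by (auto simp: lamplighter_walk_def lamplighter_states_def)
  have step: "\<rho> * F s \<le> (\<Sum>s'\<in>?St. ?Q s s' * F s')" if s: "s \<in> ?St" for s
  proof (cases "dark (fst s) \<and> snd s \<in> A")
    case True
    obtain h x where hx: "s = (h, x)" by (cases s)
    have h: "h \<in> ?V \<rightarrow>\<^sub>E UNIV" "x \<in> ?V" "dark h" "x \<in> A"
      using s True by (auto simp: hx lamplighter_states_def)
    have "(\<Sum>s'\<in>?St. ?Q s s' * F s')
        = (\<Sum>y\<in>?V. lazy_walk G x y * ((\<Sum>a\<in>UNIV. \<Sum>b\<in>UNIV. F (h(x := a, y := b), y)) / 4))"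
      unfolding hx by (rule lamplighter_step_sum[OF finite_V h(1,2)])
    also have "\<dots> = (\<Sum>y\<in>?V. lazy_walk G x y * \<phi> y)"
    proof (rule sum.cong[OF refl])
      fix y assume "y \<in> ?V"
      have "F (h(x := a, y := b), y) = \<phi> y" for a b
        using h \<phi>0[of y] by (cases "y \<in> A") (auto simp: F_def dark_def)
      then show "lazy_walk G x y * ((\<Sum>a\<in>UNIV. \<Sum>b\<in>UNIV. F (h(x := a, y := b), y)) / 4) = lazy_walk G x y * \<phi> y"
        by (simp add: sum_bits)
    qed
    also have "\<dots> \<ge> \<rho> * \<phi> x" by (rule sub[OF h(4)])
    finally show ?thesis using h by (simp add: hx F_def)
  next
    case False
    then have "F s = 0" using \<phi>0 by (auto simp: F_def)
    moreover have "0 \<le> (\<Sum>s'\<in>?St. ?Q s s' * F s')"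
      using s by (intro sum_nonneg mult_nonneg_nonneg Q_nonneg F)
    ultimately show ?thesis by simp
  qed
  define s where "s = ((\<lambda>v\<in>?V. 0) :: 'a \<Rightarrow> 2, z)"
  have s: "s \<in> ?St" and Fs: "F s = \<phi> z"
    using zV by (auto simp: s_def lamplighter_states_def F_def dark_def)
  have Qt_nonneg: "0 \<le> matrix_power ?St ?Q t s s'" if "s' \<in> ?St" for t s'
    using that s by (induction t arbitrary: s') (auto intro!: sum_nonneg mult_nonneg_nonneg Q_nonneg)
  have lower: "\<rho> ^ t * \<phi> z \<le> (\<Sum>s'\<in>?St. matrix_power ?St ?Q t s s' * F s')" for t
  proof (induction t)
    case 0
    have "(\<Sum>s'\<in>?St. matrix_power ?St ?Q 0 s s' * F s') = (\<Sum>s'\<in>?St. if s = s' then F s' else 0)"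
      by (intro sum.cong) auto
    then show ?case using s Fs finite_V by simp
  next
    case (Suc t)
    have "\<rho> ^ Suc t * \<phi> z \<le> \<rho> * (\<Sum>r\<in>?St. matrix_power ?St ?Q t s r * F r)"
      using mult_left_mono[OF Suc.IH \<rho>] by (simp add: mult.assoc)
    also have "\<dots> = (\<Sum>r\<in>?St. matrix_power ?St ?Q t s r * (\<rho> * F r))"
      by (simp add: sum_distrib_left mult_ac)
    also have "\<dots> \<le> (\<Sum>r\<in>?St. matrix_power ?St ?Q t s r * (\<Sum>s'\<in>?St. ?Q r s' * F s'))"
      by (intro sum_mono mult_left_mono step Qt_nonneg)
    also have "\<dots> = (\<Sum>s'\<in>?St. matrix_power ?St ?Q (Suc t) s s' * F s')"
      by (simp add: sum_distrib_left sum_distrib_right mult.assoc) (rule sum.swap)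
    finally show ?case .
  qed
  define K where "K = real (card ?V) * 2 ^ card ?V"
  have K: "K > 0" using card_V_pos by (simp add: K_def)
  let ?D = "PiE ?V (\<lambda>v. if v \<in> A then UNIV else {0 :: 2})"
  have card_D: "real (card ?D) = 2 ^ card A"
  proof -
    have "card ?D = (\<Prod>v\<in>?V. if v \<in> A then 2 else 1)"
      by (subst card_PiE[OF finite_V]) (intro prod.cong refl, auto)
    also have "\<dots> = (\<Prod>v\<in>A. 2)"
      using A finite_V by (intro prod.mono_neutral_cong_right) auto
    finally show ?thesis by simp
  qed
  have "\<rho> ^ t * \<phi> z \<le> (\<Sum>s'\<in>?St. matrix_power ?St ?Q t s s' * F s')" by (rule lower)
  also have "\<dots> \<le> (\<Sum>s'\<in>?St. (1 + \<epsilon>) / K * F s')"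
  proof (intro sum_mono mult_right_mono F)
    fix s' assume "s' \<in> ?St"
    then have "\<bar>matrix_power ?St ?Q t s s' - 1 / K\<bar> \<le> \<epsilon> / K"
      using mixed s unfolding uniformly_mixed_def K_def by blast
    then show "matrix_power ?St ?Q t s s' \<le> (1 + \<epsilon>) / K" by (simp add: add_divide_distrib)
  qed
  also have "\<dots> = (1 + \<epsilon>) / K * (\<Sum>s'\<in>?St. F s')" by (simp add: sum_distrib_left)
  also have "\<dots> \<le> (1 + \<epsilon>) / K * (\<phi> z * (2 ^ card A * real (card ?V)))"
  proof (rule mult_left_mono)
    have "(\<Sum>s'\<in>?St. F s') = (\<Sum>s'\<in>?D \<times> ?V. F s')"
    proof (rule sum.mono_neutral_right)
      show "finite ?St" by (simp add: finite_V)
      show "\<forall>i\<in>?St - ?D \<times> ?V. F i = 0"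
        by (auto simp: lamplighter_states_def F_def dark_def PiE_iff)
    qed (auto simp: lamplighter_states_def PiE_iff)
    also have "\<dots> \<le> real (card (?D \<times> ?V)) * \<phi> z"
      by (rule sum_bounded_above) (auto simp: F_def \<phi>)
    finally show "(\<Sum>s'\<in>?St. F s') \<le> \<phi> z * (2 ^ card A * real (card ?V))"
      by (simp add: card_cartesian_product card_D mult_ac)
  qed (use K \<epsilon> in simp)
  also have "\<dots> = (1 + \<epsilon>) * 2 ^ card A / 2 ^ card ?V * \<phi> z"
    using card_V_pos by (simp add: K_def field_simps)
  finally show ?thesis using z(2) by (simp only: mult_le_cancel_right_pos)
qed

text \<open>On the interval \<open>{0..<m}\<close> of the cycle the sine with zeros at \<open>-1\<close> and \<open>m\<close> is the ground state of the killed
walk. Choosing \<open>m = n div 2\<close> keeps the two ends of the interval apart when \<open>n \<ge> 3\<close>; for \<open>n = 2\<close> the interval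
is a single point and the eigenvalue is zero.\<close>

lemma sine_walk_step:
  fixes n :: nat and j :: int
  defines "m \<equiv> n div 2"
  defines "\<theta> \<equiv> pi / (real m + 1)"
  defines "\<psi> \<equiv> \<lambda>j::int. if 0 \<le> j \<and> j < int m then sin (\<theta> * (real_of_int j + 1)) else 0"
  assumes n: "n \<ge> 2" and j: "0 \<le> j" "j < int m"
  shows "0 < \<psi> j"
    and "real (card (steps n)) * cos \<theta> * \<psi> j \<le> (\<Sum>s\<in>steps n. \<psi> ((j + s) mod int n))"
proof -
  have m: "m \<ge> 1" using n by (simp add: m_def)
  have pos: "0 < \<psi> j" if "0 \<le> j" "j < int m" for j
  proof -
    have "real_of_int j + 1 \<le> real m" using that by linarith
    then have "\<theta> * (real_of_int j + 1) < pi"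
      using m pi_gt_zero unfolding \<theta>_def by (simp add: field_simps)
    moreover have "0 < \<theta> * (real_of_int j + 1)" using that by (simp add: \<theta>_def)
    ultimately show ?thesis using that by (simp add: \<psi>_def sin_gt_zero)
  qed
  then have nonneg: "0 \<le> \<psi> j" for j
    by (cases "0 \<le> j \<and> j < int m") (auto simp: less_imp_le \<psi>_def)
  show "0 < \<psi> j" by (rule pos[OF j])
  show "real (card (steps n)) * cos \<theta> * \<psi> j \<le> (\<Sum>s\<in>steps n. \<psi> ((j + s) mod int n))"
  proof (cases "n = 2")
    case True
    then have "cos \<theta> = 0" by (simp add: \<theta>_def m_def)
    then show ?thesis by (simp add: sum_nonneg nonneg)
  next
    case False
    then have n3: "n \<ge> 3" and mn: "int m + 1 < int n" using n by (auto simp: m_def)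
    have up: "\<psi> ((j + 1) mod int n) = sin (\<theta> * (real_of_int j + 2))"
    proof -
      have mod: "(j + 1) mod int n = j + 1" using j mn by simp
      show ?thesis
      proof (cases "j + 1 < int m")
        case True
        then show ?thesis unfolding mod using j by (simp add: \<psi>_def add.commute)
      next
        case False
        then have "real_of_int j + 2 = real m + 1" using j by linarith
        moreover have "\<theta> * (real m + 1) = pi" by (simp add: \<theta>_def add_nonneg_eq_0_iff)
        ultimately have "\<theta> * (real_of_int j + 2) = pi" by (simp only:)
        then show ?thesis unfolding mod using False by (simp add: \<psi>_def)
      qed
    qed
    have down: "sin (\<theta> * real_of_int j) \<le> \<psi> ((j + - 1) mod int n)"
    proof (cases "j = 0")
      case True
      then show ?thesis using nonneg by simp
    next
      case False
      then have "(j + - 1) mod int n = j - 1" using j mn by simp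
      then show ?thesis using j False by (simp add: \<psi>_def)
    qed
    have "2 * cos \<theta> * \<psi> j = sin (\<theta> * (real_of_int j + 1) + \<theta>) + sin (\<theta> * (real_of_int j + 1) - \<theta>)"
      using j by (simp add: \<psi>_def sin_add sin_diff)
    also have "\<dots> = sin (\<theta> * (real_of_int j + 2)) + sin (\<theta> * real_of_int j)"
      by (simp add: algebra_simps)
    also have "\<dots> \<le> \<psi> ((j + 1) mod int n) + \<psi> ((j + - 1) mod int n)"
      using up down by simp
    finally show ?thesis using False by (simp add: steps_def)
  qed
qed

text \<open>The set \<open>A\<close> is the slab, at most half of the torus, in which the first coordinate is less than \<open>n div 2\<close>. The
walk moves this coordinate only once in about \<open>d\<close> steps and needs about \<open>n\<^sup>2\<close> such moves to leave, so
survival costs a factor \<open>exp (- O(t / (d n\<^sup>2)))\<close>, while the untouched lamps, at least half of all, are worth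
a factor exponential in \<open>n ^ d\<close>.\<close>

theorem torus_mixed_imp_time_ge:
  assumes n: "n \<ge> 2" and d: "d \<ge> 1"
    and mixed: "uniformly_mixed (torus n d) \<epsilon> t" and \<epsilon>: "0 \<le> \<epsilon>" "\<epsilon> \<le> 1 / 4"
  shows "real d * (real n)\<^sup>2 * real n ^ d / 160 \<le> real t"
proof -
  define m where "m = n div 2"
  define \<theta> where "\<theta> = pi / (real m + 1)"
  define \<psi> where "\<psi> j = (if 0 \<le> j \<and> j < int m then sin (\<theta> * (real_of_int j + 1)) else 0)" for j :: int
  define A where "A = {x \<in> grid n d. x 0 < int m}"
  define \<phi> where "\<phi> x = (if x \<in> A then \<psi> (x 0) else 0)" for x
  define u where "u = (1 - cos \<theta>) / (2 * real d)"
  note \<psi>_pos = sine_walk_step(1)[OF n, folded m_def, folded \<theta>_def, folded \<psi>_def]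
  note \<psi>_step = sine_walk_step(2)[OF n, folded m_def, folded \<theta>_def, folded \<psi>_def]
  have m: "m \<ge> 1" "2 * m \<le> n" "n \<le> 2 * m + 1" using n by (auto simp: m_def)
  have A: "A \<subseteq> verts (torus n d)" by (auto simp: A_def)
  have x0: "0 \<le> x 0 \<and> x 0 < int n" if "x \<in> grid n d" for x
    using grid_memD[OF that, of 0] d by simp
  have \<phi>_pos: "0 < \<phi> x" if "x \<in> A" for x
    using that \<psi>_pos[of "x 0"] x0 by (auto simp: \<phi>_def A_def)
  have \<theta>: "0 < \<theta>" "\<theta> \<le> pi / 2" "\<theta> \<le> 8 / real n"
  proof -
    show "0 < \<theta>" by (simp add: \<theta>_def)
    show "\<theta> \<le> pi / 2" unfolding \<theta>_def using m(1) by (intro divide_left_mono) auto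
    have "\<theta> \<le> 4 / (real m + 1)" unfolding \<theta>_def using pi_less_4 by (intro divide_right_mono) auto
    also have "\<dots> \<le> 4 / (real n / 2)" using m n by (intro divide_left_mono) auto
    finally show "\<theta> \<le> 8 / real n" by simp
  qed
  have cos: "0 \<le> cos \<theta>" "cos \<theta> \<le> 1" using \<theta> by (auto intro: cos_ge_zero)
  have u: "0 \<le> u" "u \<le> 1 / 2" using cos d by (auto simp: u_def field_simps)
  have u_le: "u \<le> 16 / (real d * (real n)\<^sup>2)"
  proof -
    have "1 - cos \<theta> = 2 * (sin (\<theta> / 2))\<^sup>2"
      using cos_double_sin[of "\<theta> / 2"] by simp
    also have "\<dots> \<le> 2 * (\<theta> / 2)\<^sup>2"
      using \<theta> by (intro mult_left_mono power_mono sin_x_le_x sin_ge_zero) auto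
    also have "\<dots> \<le> 2 * (8 / real n / 2)\<^sup>2"
      using \<theta> by (intro mult_left_mono power_mono divide_right_mono) auto
    also have "\<dots> = 32 / (real n)\<^sup>2" by (simp add: power_divide)
    finally have "u \<le> 32 / (real n)\<^sup>2 / (2 * real d)"
      unfolding u_def by (rule divide_right_mono) simp
    then show ?thesis by (simp add: mult.commute)
  qed
  have sub: "(1 - u) * \<phi> x \<le> (\<Sum>y\<in>verts (torus n d). lazy_walk (torus n d) x y * \<phi> y)" if x: "x \<in> A" for x
  proof -
    define \<sigma> where "\<sigma> = real (card (steps n))"
    have \<sigma>: "\<sigma> > 0" using card_steps(1)[of n] by (simp add: \<sigma>_def)
    have xg: "x \<in> grid n d" using x by (simp add: A_def)
    have other: "\<phi> (coord_shift n i s x) = \<phi> x" if "i \<in> {..<d} - {0}" for i s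
      using that x coord_shift_in_grid[OF _ xg, of i s] n by (auto simp: \<phi>_def A_def coord_shift_def)
    have first: "\<phi> (coord_shift n 0 s x) = \<psi> ((x 0 + s) mod int n)" for s
      using coord_shift_in_grid[OF _ xg, of 0 s] n d by (auto simp: \<phi>_def A_def coord_shift_def \<psi>_def)
    have split: "(\<Sum>i<d. \<Sum>s\<in>steps n. \<phi> (coord_shift n i s x))
        = (\<Sum>s\<in>steps n. \<phi> (coord_shift n 0 s x)) + (\<Sum>i\<in>{..<d} - {0}. \<Sum>s\<in>steps n. \<phi> (coord_shift n i s x))"
      using d by (intro sum.remove) auto
    have rest: "(\<Sum>i\<in>{..<d} - {0}. \<Sum>s\<in>steps n. \<phi> (coord_shift n i s x)) = (real d - 1) * \<sigma> * \<phi> x"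
      using d by (simp add: other \<sigma>_def of_nat_diff)
    have "\<sigma> * cos \<theta> * \<phi> x \<le> (\<Sum>s\<in>steps n. \<phi> (coord_shift n 0 s x))"
      using \<psi>_step[of "x 0"] x x0[OF xg] by (simp add: first \<sigma>_def) (simp add: A_def \<phi>_def)
    then have "\<sigma> * cos \<theta> * \<phi> x + (real d - 1) * \<sigma> * \<phi> x \<le> (\<Sum>i<d. \<Sum>s\<in>steps n. \<phi> (coord_shift n i s x))"
      unfolding split rest by simp
    then have "\<phi> x / 2 + (\<sigma> * cos \<theta> * \<phi> x + (real d - 1) * \<sigma> * \<phi> x) / (2 * (real d * \<sigma>))
        \<le> \<phi> x / 2 + (\<Sum>i<d. \<Sum>s\<in>steps n. \<phi> (coord_shift n i s x)) / (2 * (real d * \<sigma>))"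
      using \<sigma> by (intro add_left_mono divide_right_mono) auto
    moreover have "\<phi> x / 2 + (\<sigma> * cos \<theta> * \<phi> x + (real d - 1) * \<sigma> * \<phi> x) / (2 * (real d * \<sigma>)) = (1 - u) * \<phi> x"
      using \<sigma> d by (simp add: u_def field_simps)
    ultimately show ?thesis
      by (simp add: torus_walk_sum[OF n xg] \<sigma>_def)
  qed
  have finA: "finite A" by (simp add: A_def)
  have "(\<lambda>i\<in>{..<d}. 0) \<in> A" using m n d by (auto simp: A_def grid_def)
  then have "A \<noteq> {}" by blast
  then have "Max (\<phi> ` A) \<in> \<phi> ` A" using finA by (intro Max_in) auto
  then obtain z where z: "z \<in> A" "\<phi> z = Max (\<phi> ` A)" by auto
  have z_max: "\<phi> x \<le> \<phi> z" if "x \<in> A" for x unfolding z(2) using that finA by (intro Max_ge) auto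
  have survival: "(1 - u) ^ t \<le> (1 + \<epsilon>) * 2 ^ card A / 2 ^ card (verts (torus n d))"
  proof (rule confined_survival_bound[OF _ A])
    show "lazy_symmetric_chain (verts (torus n d)) (lazy_walk (torus n d))"
      using lazy_symmetric_chain_torus[OF n d] by simp
    show "\<phi> x = 0" if "x \<notin> A" for x using that by (simp add: \<phi>_def)
    show "0 \<le> \<phi> x" if "x \<in> A" for x using \<phi>_pos[OF that] by simp
    show "0 \<le> 1 - u" using u by simp
    show "0 < \<phi> z" using \<phi>_pos[OF z(1)] .
  qed (use sub z(1) z_max mixed \<epsilon>(1) in auto)
  define N where "N = n ^ d"
  have card: "card (verts (torus n d)) = N" by (simp add: card_grid N_def)
  \<comment> \<open>Translation of the first coordinate by \<open>m\<close> embeds the slab into its complement.\<close>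
  have "2 * card A \<le> N"
  proof -
    have "card A \<le> card (grid n d - A)"
    proof (rule card_inj_on_le)
      show "inj_on (\<lambda>x. x(0 := x 0 + int m)) A"
      proof (rule inj_onI)
        fix x y :: "nat \<Rightarrow> int" assume eq: "x(0 := x 0 + int m) = y(0 := y 0 + int m)"
        show "x = y"
        proof
          fix i show "x i = y i" using fun_cong[OF eq, of i] by (cases "i = 0") auto
        qed
      qed
      show "(\<lambda>x. x(0 := x 0 + int m)) ` A \<subseteq> grid n d - A"
      proof (rule image_subsetI)
        fix x assume "x \<in> A"
        then have x: "x \<in> grid n d" "0 \<le> x 0" "x 0 < int m" using x0 by (auto simp: A_def)
        then have "x(0 := x 0 + int m) \<in> grid n d"
          using m d by (intro grid_update) auto
        then show "x(0 := x 0 + int m) \<in> grid n d - A" using x(2) by (simp add: A_def)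
      qed
    qed simp
    also have "\<dots> = N - card A"
      using card_Diff_subset[OF finA, of "grid n d"] by (simp add: A_def card_grid N_def)
    finally show ?thesis
      using card_mono[of "grid n d" A] by (simp add: A_def card_grid N_def)
  qed
  then have half: "real (card A) \<le> real N / 2" by linarith
  have N: "real N \<ge> 2"
  proof -
    have "2 ^ 1 \<le> n ^ d" using n d by (intro order_trans[OF power_increasing power_mono]) auto
    then show ?thesis using of_nat_mono[of 2 "n ^ d", where 'a = real] by (simp add: N_def)
  qed
  have "real t * ln (1 - u) = ln ((1 - u) ^ t)" using u by (simp add: ln_realpow)
  also have "\<dots> \<le> ln ((1 + \<epsilon>) * 2 ^ card A / 2 ^ N)"
    using survival u \<epsilon> unfolding card by (subst ln_le_cancel_iff) auto
  also have "\<dots> = ln (1 + \<epsilon>) + real (card A) * ln 2 - real N * ln 2"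
    using \<epsilon> by (simp add: ln_mult ln_div ln_realpow)
  also have "\<dots> \<le> 1 / 4 - real N / 2 * ln 2"
  proof -
    have "real (card A) * ln 2 \<le> real N / 2 * ln 2" by (rule mult_right_mono[OF half]) simp
    then show ?thesis using ln_add_one_self_le_self[OF \<epsilon>(1)] \<epsilon>(2) by linarith
  qed
  also have "\<dots> \<le> 1 / 4 - real N / 2 * (2 / 3)"
    using ln2_ge_two_thirds by (intro diff_left_mono mult_left_mono) auto
  \<comment> \<open>As \<open>N \<ge> 2\<close>, the loss of \<open>1/4\<close> from the tolerance is at most \<open>N/8\<close>.\<close>
  also have "\<dots> \<le> - (real N / 5)" using N by simp
  finally have 1: "real N / 5 \<le> real t * - ln (1 - u)" by simp
  have "- u - 2 * u\<^sup>2 \<le> ln (1 - u)" by (rule ln_one_minus_pos_lower_bound[OF u])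
  moreover have "2 * u\<^sup>2 \<le> u" using u mult_right_mono[of u "1 / 2" u] by (simp add: power2_eq_square)
  ultimately have "- ln (1 - u) \<le> 2 * u" by simp
  also have "\<dots> \<le> 32 / (real d * (real n)\<^sup>2)" using u_le by simp
  finally have "real t * - ln (1 - u) \<le> real t * (32 / (real d * (real n)\<^sup>2))"
    by (rule mult_left_mono) simp
  with 1 have "real N / 5 \<le> real t * (32 / (real d * (real n)\<^sup>2))" by linarith
  moreover have "real d * (real n)\<^sup>2 > 0" using n d by simp
  ultimately show ?thesis by (simp add: N_def field_simps)
qed

text \<open>The upper bound comes first in the argument: it exhibits a time at which the chain is mixed, without
which the \<open>LEAST\<close> in the definition of the mixing time would be an arbitrary number.\<close>

theorem t_u_torus_bounds:
  assumes n: "n \<ge> 2" and d: "d \<ge> 1"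
  shows "real d * real n ^ (d + 2) / 160 \<le> real (t_u (torus n d))"
    and "real (t_u (torus n d)) \<le> 961 * (real d * real n ^ (d + 2))"
proof -
  note chain = log_Sobolev_chain_torus[OF assms]
  have chain': "log_Sobolev_chain (verts (torus n d)) (lazy_walk (torus n d)) (16 * real d * (real n)\<^sup>2)"
    using chain by simp
  define \<epsilon> where "\<epsilon> = 1 / (2 * exp 1 :: real)"
  have "2 \<le> exp (1 :: real)" using exp_ge_add_one_self[of 1] by simp
  then have \<epsilon>: "0 \<le> \<epsilon>" "\<epsilon> \<le> 1 / 4" "1 / 6 \<le> \<epsilon>"
    using exp_le by (auto simp: \<epsilon>_def field_simps)
  define T where "T = 960 * d * n\<^sup>2 * n ^ d"
  have mono: "uniformly_mixed G b t" if "uniformly_mixed G a t" "a \<le> b" for G :: "(nat \<Rightarrow> int) graph" and a b t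
    using that unfolding uniformly_mixed_def
    by (meson divide_right_mono mult_nonneg_nonneg of_nat_0_le_iff order_trans zero_le_numeral zero_le_power)
  have "uniformly_mixed (torus n d) (1 / 6) (Suc T)"
    using chain' by (rule uniformly_mixed_after) (simp add: T_def card_grid)
  then have mixed: "uniformly_mixed (torus n d) \<epsilon> (Suc T)" using \<epsilon>(3) by (rule mono)
  have t_u: "t_u (torus n d) = (LEAST t. uniformly_mixed (torus n d) \<epsilon> t)"
    unfolding \<epsilon>_def by (rule t_u_eq[OF chain'])
  have "uniformly_mixed (torus n d) \<epsilon> (t_u (torus n d))"
    unfolding t_u using mixed by (rule LeastI)
  then have "real d * (real n)\<^sup>2 * real n ^ d / 160 \<le> real (t_u (torus n d))"
    using \<epsilon> by (intro torus_mixed_imp_time_ge[OF n d])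
  then show "real d * real n ^ (d + 2) / 160 \<le> real (t_u (torus n d))"
    by (simp add: power_add power2_eq_square mult_ac)
  have "t_u (torus n d) \<le> Suc T" unfolding t_u using mixed by (rule Least_le)
  also have "Suc T \<le> 961 * (d * n ^ (d + 2))"
  proof -
    have "1 \<le> d * n ^ (d + 2)" using n d by (simp add: Suc_le_eq)
    then show ?thesis by (simp add: T_def power_add power2_eq_square mult_ac)
  qed
  finally have "real (t_u (torus n d)) \<le> real (961 * (d * n ^ (d + 2)))"
    unfolding of_nat_le_iff .
  then show "real (t_u (torus n d)) \<le> 961 * (real d * real n ^ (d + 2))" by simp
qed

theorem theorem1p1:
  shows "\<exists>C\<^sub>1 C\<^sub>2 :: real. C\<^sub>1 > 0 \<and> C\<^sub>2 > 0 \<and>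
    (\<forall>d::nat. d \<ge> 1 \<longrightarrow>
       C\<^sub>1 \<le> real (t_u (torus 2 d)) / (real d * 2 ^ d) \<and>
       real (t_u (torus 2 d)) / (real d * 2 ^ d) \<le> C\<^sub>2) \<and>
    (\<forall>n d::nat. n \<ge> 2 \<and> d \<ge> 3 \<longrightarrow>
       C\<^sub>1 \<le> real (t_u (torus n d)) / (real d * real n ^ (d + 2)) \<and>
       real (t_u (torus n d)) / (real d * real n ^ (d + 2)) \<le> C\<^sub>2)"
proof (rule exI[of _ "1 / 160"], rule exI[of _ 3844], intro conjI allI impI)
  fix d :: nat assume d: "d \<ge> 1"
  have pos: "real d * 2 ^ d > 0" using d by simp
  note t = t_u_torus_bounds[of 2 d, OF _ d]
  have "real d * 2 ^ d / 160 \<le> real d * real 2 ^ (d + 2) / 160" by simp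
  also have "\<dots> \<le> real (t_u (torus 2 d))" using t(1) by simp
  finally show "1 / 160 \<le> real (t_u (torus 2 d)) / (real d * 2 ^ d)"
    unfolding pos_le_divide_eq[OF pos] by simp
  show "real (t_u (torus 2 d)) / (real d * 2 ^ d) \<le> 3844"
    unfolding pos_divide_le_eq[OF pos] using t(2) by (simp add: power_add mult_ac)
next
  fix n d :: nat assume nd: "n \<ge> 2 \<and> d \<ge> 3"
  then have pos: "real d * real n ^ (d + 2) > 0" by simp
  note t = t_u_torus_bounds[of n d]
  show "1 / 160 \<le> real (t_u (torus n d)) / (real d * real n ^ (d + 2))"
    unfolding pos_le_divide_eq[OF pos] using t(1) nd by simp
  have "real (t_u (torus n d)) \<le> 961 * (real d * real n ^ (d + 2))" using t(2) nd by simp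
  also have "\<dots> \<le> 3844 * (real d * real n ^ (d + 2))" using pos by simp
  finally show "real (t_u (torus n d)) / (real d * real n ^ (d + 2)) \<le> 3844"
    unfolding pos_divide_le_eq[OF pos] .
qed simp_all

end
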